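(* Let $Y=L^2(\mathbb{R}^n)$, let $v:\mathbb{R}^n\to\mathbb{R}$ be a potential and let $T=-\Delta+v(x): X\subset Y\to Y$ be self-adjoint on its domain $X$ (with the graph norm), such that: (1) the smallest point of $\sigma(T)$ is a simple isolated eigenvalue $\lambda_1$ with a positive ground state $\phi_1$; (2) the map $F:X\to Y$, $F(u)=Tu-f(u)$, is of class $C^1$; (3) $f\in C^2(\mathbb{R})$ satisfies $f(0)=0$, $M\ge f''>0$ for some constant $M$, $f'(\mathbb{R})=(a,b)$ and $a<\lambda_1<b<\min\big(\sigma(T)\setminus\{\lambda_1\}\big)$; (4) for every $u\in X$ the Jacobian $DF(u):X\to Y$ is self-adjoint, and its spectrum has as smallest point a simple isolated eigenvalue $\lambda_1(u)$ with a positive eigenfunction $\phi_1(u)$. Then $F$ is a global fold: with $H=\{y\in Y:\langle y,\phi_1\rangle_Y=0\}$, there exist homeomorphisms $\zeta:X\to H\oplus\mathbb{R}$ and $\xi:Y\to H\oplus\mathbb{R}$ such that $\xi\circ F\circ\zeta^{-1}(z,t)=(z,-t^2)$ for all $(z,t)\in H\oplus\mathbb{R}$.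
   Context: Here $f(u)$ denotes the Nemytskii operator $u\mapsto f(u(\cdot))$. *)

theory Defs
  imports "HOL-Analysis.Analysis"
begin

text \<open>R^n is the type real^'n with 'n an arbitrary finite index type (n = CARD('n)).
  Elements of L^2 are genuine equivalence classes of square-integrable
  Borel functions modulo equality almost everywhere (Lebesgue measure).\<close>

definition sq_int :: "(real^'n::finite \<Rightarrow> real) \<Rightarrow> bool" where
  "sq_int f \<longleftrightarrow> f \<in> borel_measurable lborel \<and> integrable lborel (\<lambda>x. (f x)^2)"

definition ae_class :: "(real^'n::finite \<Rightarrow> real) \<Rightarrow> (real^'n \<Rightarrow> real) set" where
  "ae_class f = {g. g \<in> borel_measurable lborel \<and> (AE x in lborel. g x = f x)}"

typedef (overloaded) ('n::finite) L2 =
  "{A :: (real^'n \<Rightarrow> real) set. \<exists>f. sq_int f \<and> A = ae_class f}"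
  morphisms L2_class L2_Abs
proof
  show "ae_class (\<lambda>_. 0) \<in> {A :: (real^'n \<Rightarrow> real) set. \<exists>f. sq_int f \<and> A = ae_class f}"
    by (auto simp: sq_int_def intro!: exI[of _ "\<lambda>_. 0"])
qed

definition rep :: "'n::finite L2 \<Rightarrow> real^'n \<Rightarrow> real" where
  "rep u = (SOME f. f \<in> L2_class u)"

definition mkL2 :: "(real^'n::finite \<Rightarrow> real) \<Rightarrow> 'n L2" where
  "mkL2 f = L2_Abs (ae_class f)"

instantiation L2 :: (finite) "{zero, plus, minus, uminus, scaleR}"
begin
definition zero_L2_def: "0 = mkL2 (\<lambda>_. 0)"
definition plus_L2_def: "u + w = mkL2 (\<lambda>x. rep u x + rep w x)"
definition minus_L2_def: "u - w = mkL2 (\<lambda>x. rep u x - rep w x)"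
definition uminus_L2_def: "- u = mkL2 (\<lambda>x. - rep u x)"
definition scaleR_L2_def: "c *\<^sub>R u = mkL2 (\<lambda>x. c * rep u x)"
instance ..
end

definition L2_norm :: "'n::finite L2 \<Rightarrow> real" where
  "L2_norm u = sqrt (\<integral>x. (rep u x)^2 \<partial>lborel)"

definition L2_inner :: "'n::finite L2 \<Rightarrow> 'n L2 \<Rightarrow> real" where
  "L2_inner u w = (\<integral>x. rep u x * rep w x \<partial>lborel)"

definition nemytskii :: "(real \<Rightarrow> real) \<Rightarrow> 'n::finite L2 \<Rightarrow> 'n L2" where
  "nemytskii f u = mkL2 (\<lambda>x. f (rep u x))"

definition self_adjoint :: "('n::finite L2 \<Rightarrow> 'n L2) \<Rightarrow> 'n L2 set \<Rightarrow> bool" where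
  "self_adjoint A D \<longleftrightarrow>
     0 \<in> D \<and>
     (\<forall>u\<in>D. \<forall>w\<in>D. u + w \<in> D \<and> A (u + w) = A u + A w) \<and>
     (\<forall>c. \<forall>u\<in>D. c *\<^sub>R u \<in> D \<and> A (c *\<^sub>R u) = c *\<^sub>R A u) \<and>
     (\<forall>y. \<forall>\<epsilon>>0. \<exists>u\<in>D. L2_norm (y - u) < \<epsilon>) \<and>
     (\<forall>u\<in>D. \<forall>w\<in>D. L2_inner (A u) w = L2_inner u (A w)) \<and>
     (\<forall>w z. (\<forall>u\<in>D. L2_inner (A u) w = L2_inner u z) \<longrightarrow> w \<in> D \<and> A w = z)"

definition op_spectrum :: "('n::finite L2 \<Rightarrow> 'n L2) \<Rightarrow> 'n L2 set \<Rightarrow> real set" where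
  "op_spectrum A D = {\<mu>. \<not> (bij_betw (\<lambda>u. A u - \<mu> *\<^sub>R u) D UNIV \<and>
                         (\<exists>C. \<forall>u\<in>D. L2_norm u \<le> C * L2_norm (A u - \<mu> *\<^sub>R u)))}"

definition ground_state :: "('n::finite L2 \<Rightarrow> 'n L2) \<Rightarrow> 'n L2 set \<Rightarrow> real \<Rightarrow> 'n L2 \<Rightarrow> bool" where
  "ground_state A D lam phi \<longleftrightarrow>
     lam \<in> op_spectrum A D \<and> (\<forall>\<mu>\<in>op_spectrum A D. lam \<le> \<mu>) \<and>
     (\<exists>\<epsilon>>0. \<forall>\<mu>\<in>op_spectrum A D. \<bar>\<mu> - lam\<bar> < \<epsilon> \<longrightarrow> \<mu> = lam) \<and>
     phi \<in> D \<and> phi \<noteq> 0 \<and> A phi = lam *\<^sub>R phi \<and>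
     (\<forall>u\<in>D. A u = lam *\<^sub>R u \<longrightarrow> (\<exists>c. u = c *\<^sub>R phi)) \<and>
     (AE x in lborel. 0 < rep phi x)"

definition pder :: "'n::finite \<Rightarrow> (real^'n \<Rightarrow> real) \<Rightarrow> real^'n \<Rightarrow> real" where
  "pder i g x = deriv (\<lambda>t. g (x + t *\<^sub>R axis i 1)) 0"

fun pders :: "'n::finite list \<Rightarrow> (real^'n \<Rightarrow> real) \<Rightarrow> real^'n \<Rightarrow> real" where
  "pders [] g = g"
| "pders (i # is) g = pder i (pders is g)"

definition test_fun :: "(real^'n::finite \<Rightarrow> real) \<Rightarrow> bool" where
  "test_fun \<phi> \<longleftrightarrow>
     (\<forall>is i x. (\<lambda>t. pders is \<phi> (x + t *\<^sub>R axis i 1)) differentiable (at 0)) \<and>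
     (\<forall>is. continuous_on UNIV (pders is \<phi>)) \<and>
     compact (closure {x. \<phi> x \<noteq> 0})"

definition laplacian :: "(real^'n::finite \<Rightarrow> real) \<Rightarrow> real^'n \<Rightarrow> real" where
  "laplacian \<phi> x = (\<Sum>i\<in>UNIV. pder i (pder i \<phi>) x)"

definition schroedinger_op :: "(real^'n::finite \<Rightarrow> real) \<Rightarrow> ('n L2 \<Rightarrow> 'n L2) \<Rightarrow> 'n L2 set \<Rightarrow> bool" where
  "schroedinger_op v T X \<longleftrightarrow>
     (\<forall>u\<in>X. \<forall>\<phi>. test_fun \<phi> \<longrightarrow>
        integrable lborel (\<lambda>x. v x * rep u x * \<phi> x) \<and>
        (\<integral>x. rep (T u) x * \<phi> x \<partial>lborel) =
          (\<integral>x. rep u x * (- laplacian \<phi> x) \<partial>lborel) + (\<integral>x. v x * rep u x * \<phi> x \<partial>lborel))"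

definition gnorm :: "('n::finite L2 \<Rightarrow> 'n L2) \<Rightarrow> 'n L2 \<Rightarrow> real" where
  "gnorm T u = L2_norm u + L2_norm (T u)"

definition frechet_C1 :: "('n::finite L2 \<Rightarrow> 'n L2) \<Rightarrow> 'n L2 set \<Rightarrow> ('n L2 \<Rightarrow> 'n L2)
     \<Rightarrow> ('n L2 \<Rightarrow> 'n L2 \<Rightarrow> 'n L2) \<Rightarrow> bool" where
  "frechet_C1 T X F DF \<longleftrightarrow>
     (\<forall>u\<in>X.
        (\<forall>h\<in>X. \<forall>k\<in>X. \<forall>c. DF u (h + k) = DF u h + DF u k \<and> DF u (c *\<^sub>R h) = c *\<^sub>R DF u h) \<and>
        (\<exists>C. \<forall>h\<in>X. L2_norm (DF u h) \<le> C * gnorm T h) \<and>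
        (\<forall>\<epsilon>>0. \<exists>\<delta>>0. \<forall>w\<in>X. gnorm T (w - u) < \<delta> \<longrightarrow>
            L2_norm (F w - F u - DF u (w - u)) \<le> \<epsilon> * gnorm T (w - u))) \<and>
     (\<forall>u\<in>X. \<forall>\<epsilon>>0. \<exists>\<delta>>0. \<forall>w\<in>X. gnorm T (w - u) < \<delta> \<longrightarrow>
            (\<forall>h\<in>X. L2_norm (DF w h - DF u h) \<le> \<epsilon> * gnorm T h))"

definition cont_between :: "'a set \<Rightarrow> ('a \<Rightarrow> 'a \<Rightarrow> real) \<Rightarrow> ('b \<Rightarrow> 'b \<Rightarrow> real) \<Rightarrow> ('a \<Rightarrow> 'b) \<Rightarrow> bool" where
  "cont_between S d d' g \<longleftrightarrow>
     (\<forall>x\<in>S. \<forall>\<epsilon>>0. \<exists>\<delta>>0. \<forall>y\<in>S. d x y < \<delta> \<longrightarrow> d' (g x) (g y) < \<epsilon>)"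

definition homeo_between :: "'a set \<Rightarrow> ('a \<Rightarrow> 'a \<Rightarrow> real) \<Rightarrow> 'b set \<Rightarrow> ('b \<Rightarrow> 'b \<Rightarrow> real)
     \<Rightarrow> ('a \<Rightarrow> 'b) \<Rightarrow> bool" where
  "homeo_between S d S' d' g \<longleftrightarrow>
     bij_betw g S S' \<and> cont_between S d d' g \<and> cont_between S' d' d (inv_into S g)"

definition sum_dist :: "'n::finite L2 \<times> real \<Rightarrow> 'n L2 \<times> real \<Rightarrow> real" where
  "sum_dist p q = L2_norm (fst p - fst q) + \<bar>snd p - snd q\<bar>"

end

theory Submission
  imports Defs
begin

text \<open>
  Let \<open>P\<close> be the orthogonal projection onto the complement \<open>H\<close> of the normalized ground state \<open>\<phi>\<close>.
  There \<open>T \<ge> \<beta>\<close> for some \<open>\<beta> > b\<close>, while \<open>f(x) - \<gamma> x\<close> has Lipschitz constant \<open>\<gamma> - a < \<beta> - \<gamma>\<close> for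
  suitable \<open>\<gamma>\<close>. A contraction argument thus solves \<open>P(F(u)) = z\<close>, \<open>\<langle>u, \<phi>\<rangle> = t\<close> by a unique
  \<open>u(z, t)\<close>, Lipschitz in \<open>(z, t)\<close>. In these coordinates \<open>F\<close> only changes the height
  \<open>G(z, t) = \<langle>F(u(z, t)), \<phi>\<rangle>\<close>. The slopes of \<open>G(z, \<cdot>)\<close> at \<open>\<plusminus>\<infinity>\<close> are \<open>lam - b < 0\<close> and \<open>lam - a > 0\<close>.
  At a critical point the tangent of the fiber lies in the kernel of \<open>DF(u)\<close> and is a positive ground
  state; convexity of \<open>f\<close> then makes the point a strict global maximum. So every \<open>G(z, \<cdot>)\<close>
  is unimodal, and the signed square root of the distance to its maximum straightens it to \<open>-s\<^sup>2\<close>.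
\<close>

section \<open>The Hilbert space of square-integrable classes\<close>

lemma L2_class_ex: "\<exists>f. sq_int f \<and> L2_class u = ae_class f"
  using L2_class[of u] by auto

lemma rep_in_class: "rep u \<in> L2_class u"
proof -
  obtain f where f: "sq_int f" "L2_class u = ae_class f"
    using L2_class_ex by blast
  then have "f \<in> L2_class u"
    by (auto simp: ae_class_def sq_int_def)
  then show ?thesis
    unfolding rep_def by (rule someI[of "\<lambda>h. h \<in> L2_class u"])
qed

lemma ae_class_cong:
  assumes "f \<in> borel_measurable lborel" "g \<in> borel_measurable lborel" "AE x in lborel. g x = f x"
  shows "ae_class g = ae_class f"
proof (rule set_eqI)
  fix h
  have "(AE x in lborel. h x = g x) \<longleftrightarrow> (AE x in lborel. h x = f x)"
    using assms(3) by (auto elim: AE_mp)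
  then show "h \<in> ae_class g \<longleftrightarrow> h \<in> ae_class f"
    by (simp add: ae_class_def)
qed

lemma sq_int_cong_AE:
  assumes "sq_int f" "g \<in> borel_measurable lborel" "AE x in lborel. g x = f x"
  shows "sq_int g"
  unfolding sq_int_def
proof
  have [measurable]: "f \<in> borel_measurable lborel" "g \<in> borel_measurable lborel"
    using assms by (auto simp: sq_int_def)
  show "integrable lborel (\<lambda>x. (g x)\<^sup>2)"
    using assms(1) by (subst integrable_cong_AE[where g = "\<lambda>x. (f x)\<^sup>2"])
      (use assms(3) in \<open>auto simp: sq_int_def elim: AE_mp\<close>)
qed fact

lemma class_rep: "sq_int (rep u)" "L2_class u = ae_class (rep u)"
proof -
  obtain f where f: "sq_int f" "L2_class u = ae_class f"
    using L2_class_ex by blast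
  then have m: "rep u \<in> borel_measurable lborel" "AE x in lborel. rep u x = f x"
    using rep_in_class[of u] by (auto simp: ae_class_def)
  show "sq_int (rep u)"
    using sq_int_cong_AE[OF f(1) m] .
  show "L2_class u = ae_class (rep u)"
    using f ae_class_cong[OF _ m] by (simp add: sq_int_def)
qed

lemmas sq_int_rep = class_rep(1)

lemma rep_measurable [measurable]: "rep u \<in> borel_measurable lborel"
  using sq_int_rep[of u] by (simp add: sq_int_def)

lemma mkL2_rep: "mkL2 (rep u) = u"
  unfolding mkL2_def class_rep(2)[symmetric] by (rule L2_class_inverse)

lemma rep_mkL2:
  assumes "sq_int f"
  shows "AE x in lborel. rep (mkL2 f) x = f x"
proof -
  have "L2_class (mkL2 f) = ae_class f"
    unfolding mkL2_def by (rule L2_Abs_inverse) (use assms in blast)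
  then show ?thesis
    using rep_in_class[of "mkL2 f"] by (simp add: ae_class_def)
qed

lemma L2_eqI:
  assumes "AE x in lborel. rep u x = rep w x"
  shows "u = w"
proof -
  have "ae_class (rep u) = ae_class (rep w)"
    by (rule ae_class_cong) (use assms in auto)
  then show ?thesis
    by (metis mkL2_def mkL2_rep)
qed

lemma sq_int_mult:
  assumes "sq_int f" "sq_int g"
  shows "integrable lborel (\<lambda>x. f x * g x)"
proof (rule Bochner_Integration.integrable_bound)
  show "integrable lborel (\<lambda>x. (f x)\<^sup>2 + (g x)\<^sup>2)"
    using assms by (auto simp: sq_int_def)
  show "(\<lambda>x. f x * g x) \<in> borel_measurable lborel"
    using assms by (auto simp: sq_int_def)
  have "\<bar>p * q\<bar> \<le> \<bar>p\<^sup>2 + q\<^sup>2\<bar>" for p q :: real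
  proof -
    have "2 * (\<bar>p\<bar> * \<bar>q\<bar>) \<le> p\<^sup>2 + q\<^sup>2"
      using sum_squares_bound[of "\<bar>p\<bar>" "\<bar>q\<bar>"] by simp
    moreover have "0 \<le> \<bar>p\<bar> * \<bar>q\<bar>" by simp
    ultimately have "\<bar>p\<bar> * \<bar>q\<bar> \<le> p\<^sup>2 + q\<^sup>2" by linarith
    then show ?thesis by (simp add: abs_mult)
  qed
  then show "AE x in lborel. norm (f x * g x) \<le> norm ((f x)\<^sup>2 + (g x)\<^sup>2)"
    by simp
qed

lemma sq_int_add:
  assumes "sq_int f" "sq_int g"
  shows "sq_int (\<lambda>x. f x + g x)"
proof -
  have "integrable lborel (\<lambda>x. (f x)\<^sup>2 + (g x)\<^sup>2 + 2 * (f x * g x))"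
    using assms sq_int_mult[OF assms] by (auto simp: sq_int_def)
  then show ?thesis
    using assms by (auto simp: sq_int_def power2_sum mult.assoc)
qed

lemma sq_int_cmult: "sq_int f \<Longrightarrow> sq_int (\<lambda>x. c * f x)"
  by (auto simp: sq_int_def power_mult_distrib)

lemma sq_int_minus: "sq_int f \<Longrightarrow> sq_int (\<lambda>x. - f x)"
  using sq_int_cmult[of f "-1"] by simp

lemma sq_int_diff: "sq_int f \<Longrightarrow> sq_int g \<Longrightarrow> sq_int (\<lambda>x. f x - g x)"
  using sq_int_add[OF _ sq_int_minus] by fastforce

lemma sq_int_bound:
  assumes "sq_int g" "h \<in> borel_measurable lborel" "AE x in lborel. \<bar>h x\<bar> \<le> C * \<bar>g x\<bar>"
  shows "sq_int h"
  unfolding sq_int_def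
proof
  show "integrable lborel (\<lambda>x. (h x)\<^sup>2)"
  proof (rule Bochner_Integration.integrable_bound)
    show "integrable lborel (\<lambda>x. (C * g x)\<^sup>2)"
      using sq_int_cmult[OF assms(1)] by (simp add: sq_int_def)
    have "p\<^sup>2 \<le> (C * q)\<^sup>2" if "\<bar>p\<bar> \<le> C * \<bar>q\<bar>" for p q :: real
      using power_mono[OF that, of 2] by (simp add: power_mult_distrib)
    then show "AE x in lborel. norm ((h x)\<^sup>2) \<le> norm ((C * g x)\<^sup>2)"
      using assms(3) by (auto elim: AE_mp)
  qed (use assms in simp)
qed fact

lemma rep_zero: "AE x in lborel. rep 0 x = 0"
  unfolding zero_L2_def by (rule rep_mkL2) (simp add: sq_int_def)

lemma rep_add: "AE x in lborel. rep (u + w) x = rep u x + rep w x"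
  unfolding plus_L2_def by (intro rep_mkL2 sq_int_add sq_int_rep)

lemma rep_diff: "AE x in lborel. rep (u - w) x = rep u x - rep w x"
  unfolding minus_L2_def by (intro rep_mkL2 sq_int_diff sq_int_rep)

lemma rep_uminus: "AE x in lborel. rep (- u) x = - rep u x"
  unfolding uminus_L2_def by (intro rep_mkL2 sq_int_minus sq_int_rep)

lemma rep_scaleR: "AE x in lborel. rep (c *\<^sub>R u) x = c * rep u x"
  unfolding scaleR_L2_def by (intro rep_mkL2 sq_int_cmult sq_int_rep)

lemma L2_inner_cong:
  assumes "AE x in lborel. rep u x * rep w x = g x" "g \<in> borel_measurable lborel"
  shows "L2_inner u w = (\<integral>x. g x \<partial>lborel)"
  unfolding L2_inner_def by (rule integral_cong_AE) (use assms in \<open>auto elim: AE_mp\<close>)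

instantiation L2 :: (finite) real_inner
begin

definition norm_L2_def: "norm u = L2_norm u"
definition inner_L2_def: "inner u w = L2_inner u w"
definition dist_L2_def: "dist u w = norm (u - w :: 'a L2)"
definition sgn_L2_def: "sgn u = inverse (norm u) *\<^sub>R (u :: 'a L2)"
definition uniformity_L2_def:
  "(uniformity :: ('a L2 \<times> 'a L2) filter) = (INF e\<in>{0<..}. principal {(x, y). dist x y < e})"
definition open_L2_def:
  "open (U :: 'a L2 set) \<longleftrightarrow> (\<forall>x\<in>U. eventually (\<lambda>(x', y). x' = x \<longrightarrow> y \<in> U) uniformity)"

instance
proof
  fix x y z :: "'a L2" and r s :: real
  show "x + y + z = x + (y + z)"
    using rep_add[of "x + y" z] rep_add[of x "y + z"] rep_add[of x y] rep_add[of y z]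
    by (intro L2_eqI) auto
  show "x + y = y + x"
    using rep_add[of x y] rep_add[of y x] by (intro L2_eqI) auto
  show "0 + x = x"
    using rep_add[of 0 x] rep_zero by (intro L2_eqI) auto
  show "- x + x = 0"
    using rep_add[of "- x" x] rep_uminus[of x] rep_zero by (intro L2_eqI) auto
  show "x - y = x + - y"
    using rep_add[of x "- y"] rep_uminus[of y] rep_diff[of x y] by (intro L2_eqI) auto
  show "r *\<^sub>R (x + y) = r *\<^sub>R x + r *\<^sub>R y"
    using rep_scaleR[of r "x + y"] rep_add[of x y] rep_add[of "r *\<^sub>R x" "r *\<^sub>R y"]
      rep_scaleR[of r x] rep_scaleR[of r y]
    by (intro L2_eqI) (auto simp: algebra_simps)
  show "(r + s) *\<^sub>R x = r *\<^sub>R x + s *\<^sub>R x"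
    using rep_scaleR[of "r + s" x] rep_add[of "r *\<^sub>R x" "s *\<^sub>R x"] rep_scaleR[of r x] rep_scaleR[of s x]
    by (intro L2_eqI) (auto simp: algebra_simps)
  show "r *\<^sub>R s *\<^sub>R x = (r * s) *\<^sub>R x"
    using rep_scaleR[of r "s *\<^sub>R x"] rep_scaleR[of s x] rep_scaleR[of "r * s" x]
    by (intro L2_eqI) auto
  show "1 *\<^sub>R x = x"
    using rep_scaleR[of 1 x] by (intro L2_eqI) auto
  show "dist x y = norm (x - y)" "sgn x = inverse (norm x) *\<^sub>R x"
    by (simp_all add: dist_L2_def sgn_L2_def)
  show "inner x y = inner y x"
    by (simp add: inner_L2_def L2_inner_def mult.commute)
  have "L2_inner (x + y) z = (\<integral>t. rep x t * rep z t + rep y t * rep z t \<partial>lborel)"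
    by (rule L2_inner_cong) (use rep_add[of x y] in \<open>auto simp: algebra_simps\<close>)
  also have "\<dots> = L2_inner x z + L2_inner y z"
    unfolding L2_inner_def by (intro Bochner_Integration.integral_add sq_int_mult sq_int_rep)
  finally show "inner (x + y) z = inner x z + inner y z"
    by (simp add: inner_L2_def)
  have "L2_inner (r *\<^sub>R x) y = (\<integral>t. r * (rep x t * rep y t) \<partial>lborel)"
    by (rule L2_inner_cong) (use rep_scaleR[of r x] in \<open>auto simp: algebra_simps\<close>)
  then show "inner (r *\<^sub>R x) y = r * inner x y"
    by (simp add: inner_L2_def L2_inner_def)
  show "0 \<le> inner x x"
    by (simp add: inner_L2_def L2_inner_def)
  have "integrable lborel (\<lambda>t. rep x t * rep x t)"
    by (intro sq_int_mult sq_int_rep)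
  then have "inner x x = 0 \<longleftrightarrow> (AE t in lborel. rep x t * rep x t = 0)"
    unfolding inner_L2_def L2_inner_def by (subst integral_nonneg_eq_0_iff_AE) auto
  also have "\<dots> \<longleftrightarrow> x = 0"
    using rep_zero by (auto intro: L2_eqI elim: AE_mp)
  finally show "inner x x = 0 \<longleftrightarrow> x = 0" .
  show "norm x = sqrt (inner x x)"
    by (simp add: norm_L2_def L2_norm_def inner_L2_def L2_inner_def power2_eq_square)
qed (simp_all add: uniformity_L2_def open_L2_def)

end

lemma norm_L2_sq: "(norm (u :: 'n::finite L2))\<^sup>2 = (\<integral>x. (rep u x)\<^sup>2 \<partial>lborel)"
  by (simp add: norm_L2_def L2_norm_def)

lemma nn_integral_L2:
  "(\<integral>\<^sup>+x. ennreal ((rep u x)\<^sup>2) \<partial>lborel) = ennreal ((norm (u :: 'n::finite L2))\<^sup>2)"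
  unfolding norm_L2_sq using sq_int_rep[of u]
  by (intro nn_integral_eq_integral) (auto simp: sq_int_def)

lemma L2_AE_Cauchy:
  fixes X :: "nat \<Rightarrow> 'n::finite L2"
  assumes fast: "\<And>k. norm (X (Suc k) - X k) \<le> (1/2)^k"
  shows "AE x in lborel. convergent (\<lambda>k. rep (X k) x)"
proof -
  define d where "d k = X (Suc k) - X k" for k
  have "(\<integral>\<^sup>+x. (\<Sum>k. ennreal (2^k * (rep (d k) x)\<^sup>2)) \<partial>lborel)
      = (\<Sum>k. \<integral>\<^sup>+x. ennreal (2^k * (rep (d k) x)\<^sup>2) \<partial>lborel)"
    by (intro nn_integral_suminf) measurable
  also have "\<dots> = (\<Sum>k. ennreal (2^k * (norm (d k))\<^sup>2))"
    by (simp add: ennreal_mult nn_integral_cmult nn_integral_L2)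
  also have "\<dots> \<le> (\<Sum>k. ennreal ((1/2)^k))"
  proof (intro suminf_le allI ennreal_leI)
    fix k
    have "(norm (d k))\<^sup>2 \<le> ((1/2)^k)\<^sup>2"
      using fast[of k] by (intro power_mono) (auto simp: d_def)
    then have "2^k * (norm (d k))\<^sup>2 \<le> 2^k * ((1/2)^k)\<^sup>2"
      by (intro mult_left_mono) auto
    also have "\<dots> = (1/2)^k"
      by (simp add: power2_eq_square power_one_over divide_simps)
    finally show "2^k * (norm (d k))\<^sup>2 \<le> (1/2)^k" .
  qed auto
  also have "\<dots> = ennreal (\<Sum>k. (1/2)^k)"
    by (intro suminf_ennreal2) (auto simp: summable_geometric)
  also have "\<dots> < \<infinity>" by simp
  finally have "AE x in lborel. (\<Sum>k. ennreal (2^k * (rep (d k) x)\<^sup>2)) \<noteq> \<infinity>"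
    by (intro nn_integral_noteq_infinite) auto
  moreover have "AE x in lborel. \<forall>k. rep (d k) x = rep (X (Suc k)) x - rep (X k) x"
    unfolding AE_all_countable d_def by (intro allI rep_diff)
  ultimately show ?thesis
  proof eventually_elim
    case (elim x)
    have S: "summable (\<lambda>k. 2^k * (rep (d k) x)\<^sup>2)"
      using elim(1) by (intro summable_suminf_not_top) (auto simp: top_ennreal_def)
    have "summable (\<lambda>k. \<bar>rep (d k) x\<bar>)"
    proof (rule summable_comparison_test')
      show "summable (\<lambda>k. 2^k * (rep (d k) x)\<^sup>2 + (1/2)^k)"
        using S by (intro summable_add) (auto simp: summable_geometric)
      fix k :: nat
      let ?e = "\<bar>rep (d k) x\<bar>"
      have "2 * (2^k * ?e) * 1 \<le> (2^k * ?e)\<^sup>2 + 1\<^sup>2"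
        by (rule sum_squares_bound)
      then have "2^k * ?e \<le> (2^k * ?e)\<^sup>2 + 1"
        by (smt (verit) zero_le_power mult_nonneg_nonneg one_power2 abs_ge_zero zero_le_numeral)
      then have "2^k * ?e \<le> 2^k * (2^k * ?e\<^sup>2 + (1/2)^k)"
        by (simp add: power2_eq_square power_one_over algebra_simps)
      then show "norm ?e \<le> 2^k * (rep (d k) x)\<^sup>2 + (1/2)^k"
        by simp
    qed
    then have "summable (\<lambda>k. rep (d k) x)"
      by (rule summable_rabs_cancel)
    then have "summable (\<lambda>k. rep (X (Suc k)) x - rep (X k) x)"
      using elim(2) by simp
    then have "convergent (\<lambda>n. \<Sum>k<n. rep (X (Suc k)) x - rep (X k) x)"
      by (simp add: summable_iff_convergent)
    then have "convergent (\<lambda>n. (rep (X n) x - rep (X 0) x))"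
      using sum_lessThan_telescope[of "\<lambda>k. rep (X k) x"] by simp
    then show ?case
      using convergent_diff_const_right_iff by blast
  qed
qed

lemma L2_fast_Cauchy:
  fixes X :: "nat \<Rightarrow> 'n::finite L2"
  assumes "Cauchy X" and fast: "\<And>k. norm (X (Suc k) - X k) \<le> (1/2)^k"
  shows "convergent X"
proof -
  define g where "g x = lim (\<lambda>k. rep (X k) x)" for x
  have [measurable]: "g \<in> borel_measurable lborel"
    unfolding g_def by measurable
  have lim: "AE x in lborel. (\<lambda>k. rep (X k) x) \<longlonglongrightarrow> g x"
    using L2_AE_Cauchy[OF fast] by (auto simp: g_def convergent_LIMSEQ_iff elim: AE_mp)
  have fatou: "(\<integral>\<^sup>+x. ennreal ((rep (X k) x - g x)\<^sup>2) \<partial>lborel) \<le> ennreal (e\<^sup>2)"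
    if e: "\<And>j. j \<ge> k \<Longrightarrow> norm (X k - X j) \<le> e" for k e
  proof -
    have "(\<integral>\<^sup>+x. ennreal ((rep (X k) x - g x)\<^sup>2) \<partial>lborel)
        = (\<integral>\<^sup>+x. liminf (\<lambda>j. ennreal ((rep (X k) x - rep (X j) x)\<^sup>2)) \<partial>lborel)"
    proof (rule nn_integral_cong_AE)
      show "AE x in lborel. ennreal ((rep (X k) x - g x)\<^sup>2)
          = liminf (\<lambda>j. ennreal ((rep (X k) x - rep (X j) x)\<^sup>2))"
        using lim
      proof eventually_elim
        case (elim x)
        have "(\<lambda>j. ennreal ((rep (X k) x - rep (X j) x)\<^sup>2)) \<longlonglongrightarrow> ennreal ((rep (X k) x - g x)\<^sup>2)"
          by (intro tendsto_intros elim)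
        then show ?case
          by (intro lim_imp_Liminf[symmetric]) auto
      qed
    qed
    also have "\<dots> \<le> liminf (\<lambda>j. \<integral>\<^sup>+x. ennreal ((rep (X k) x - rep (X j) x)\<^sup>2) \<partial>lborel)"
      by (intro nn_integral_liminf) measurable
    also have "\<dots> = liminf (\<lambda>j. ennreal ((norm (X k - X j))\<^sup>2))"
    proof (intro arg_cong[where f = liminf] ext)
      fix j
      show "(\<integral>\<^sup>+x. ennreal ((rep (X k) x - rep (X j) x)\<^sup>2) \<partial>lborel) = ennreal ((norm (X k - X j))\<^sup>2)"
        unfolding nn_integral_L2[symmetric]
        by (rule nn_integral_cong_AE) (use rep_diff[of "X k" "X j"] in \<open>auto elim: AE_mp\<close>)
    qed
    also have "\<dots> \<le> liminf (\<lambda>j. ennreal (e\<^sup>2))"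
    proof (rule Liminf_mono)
      show "eventually (\<lambda>j. ennreal ((norm (X k - X j))\<^sup>2) \<le> ennreal (e\<^sup>2)) sequentially"
        using eventually_ge_at_top[of k]
        by eventually_elim (use e in \<open>auto intro!: ennreal_leI power_mono\<close>)
    qed
    also have "\<dots> = ennreal (e\<^sup>2)"
      by (simp add: Liminf_const)
    finally show ?thesis .
  qed
  have sq: "sq_int (\<lambda>x. rep (X k) x - g x)" if e: "\<And>j. j \<ge> k \<Longrightarrow> norm (X k - X j) \<le> e" for k e
    unfolding sq_int_def
  proof
    have "(\<integral>\<^sup>+x. ennreal (norm ((rep (X k) x - g x)\<^sup>2)) \<partial>lborel) < \<infinity>"
      using fatou[OF e] by (auto intro: le_less_trans)
    then show "integrable lborel (\<lambda>x. (rep (X k) x - g x)\<^sup>2)"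
      by (subst integrable_iff_bounded) auto
  qed simp
  obtain K where K: "\<And>m n. m \<ge> K \<Longrightarrow> n \<ge> K \<Longrightarrow> norm (X m - X n) < 1"
    using CauchyD[OF assms(1), of 1] by auto
  have sqK: "sq_int (\<lambda>x. rep (X K) x - g x)"
    by (rule sq) (use K less_imp_le in blast)
  have gs: "sq_int g"
    using sq_int_diff[OF sq_int_rep[of "X K"] sqK] by simp
  have "X \<longlonglongrightarrow> mkL2 g"
  proof (rule LIMSEQ_I)
    fix r :: real assume r: "r > 0"
    obtain N where N: "\<And>m n. m \<ge> N \<Longrightarrow> n \<ge> N \<Longrightarrow> norm (X m - X n) < r/2"
      using CauchyD[OF assms(1), of "r/2"] r by auto
    have "norm (X k - mkL2 g) < r" if k: "k \<ge> N" for k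
    proof -
      have "ennreal ((norm (X k - mkL2 g))\<^sup>2) = (\<integral>\<^sup>+x. ennreal ((rep (X k) x - g x)\<^sup>2) \<partial>lborel)"
        unfolding nn_integral_L2[symmetric]
        by (rule nn_integral_cong_AE) (use rep_diff[of "X k" "mkL2 g"] rep_mkL2[OF gs] in \<open>auto elim: AE_mp\<close>)
      also have "\<dots> \<le> ennreal ((r/2)\<^sup>2)"
        by (rule fatou) (use N k less_imp_le in \<open>meson le_trans\<close>)
      finally have "(norm (X k - mkL2 g))\<^sup>2 \<le> (r/2)\<^sup>2"
        by (subst (asm) ennreal_le_iff) auto
      then have "norm (X k - mkL2 g) \<le> r/2"
        by (rule power2_le_imp_le) (use r in simp)
      then show ?thesis using r by simp
    qed
    then show "\<exists>no. \<forall>n\<ge>no. norm (X n - mkL2 g) < r" by blast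
  qed
  then show ?thesis by (rule convergentI)
qed

instance L2 :: (finite) complete_space
proof
  fix X :: "nat \<Rightarrow> 'a L2" assume X: "Cauchy X"
  have "\<forall>k. \<exists>N. \<forall>m\<ge>N. \<forall>n\<ge>N. norm (X m - X n) < (1/2)^k"
    using CauchyD[OF X] by (metis zero_less_power half_gt_zero_iff zero_less_one)
  then obtain N where N: "\<And>k m n. m \<ge> N k \<Longrightarrow> n \<ge> N k \<Longrightarrow> norm (X m - X n) < (1/2)^k"
    by metis
  define r where "r k = (\<Sum>i\<le>k. N i) + k" for k
  have r: "strict_mono r"
    by (intro strict_monoI_Suc) (simp add: r_def)
  have rN: "r k \<ge> N k" for k
    using sum_nonneg_leq_bound by (simp add: r_def atMost_Suc member_le_sum trans_le_add1)
  have "convergent (X \<circ> r)"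
  proof (rule L2_fast_Cauchy)
    show "Cauchy (X \<circ> r)"
      using X r by (rule Cauchy_subseq_Cauchy)
    fix k
    have "r (Suc k) \<ge> N k"
      using rN[of k] strict_monoD[OF r, of k "Suc k"] by simp
    then show "norm ((X \<circ> r) (Suc k) - (X \<circ> r) k) \<le> (1/2)^k"
      using N[of k "r (Suc k)" "r k"] rN[of k] by simp
  qed
  then show "convergent X"
    using Cauchy_converges_subseq[OF X r] by (auto simp: convergent_def)
qed

section \<open>Spectral gap estimates\<close>

definition regular_point :: "('a::real_inner \<Rightarrow> 'a) \<Rightarrow> 'a set \<Rightarrow> real \<Rightarrow> bool" where
  "regular_point T X c \<longleftrightarrow> bij_betw (\<lambda>u. T u - c *\<^sub>R u) X UNIV \<and>
     (\<exists>C. \<forall>u\<in>X. norm u \<le> C * norm (T u - c *\<^sub>R u))"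

locale symmetric_operator =
  fixes T :: "'a::real_inner \<Rightarrow> 'a" and X :: "'a set"
  assumes zero_in: "0 \<in> X"
    and add_in: "u \<in> X \<Longrightarrow> w \<in> X \<Longrightarrow> u + w \<in> X"
    and scale_in: "u \<in> X \<Longrightarrow> c *\<^sub>R u \<in> X"
    and T_add: "u \<in> X \<Longrightarrow> w \<in> X \<Longrightarrow> T (u + w) = T u + T w"
    and T_scale: "u \<in> X \<Longrightarrow> T (c *\<^sub>R u) = c *\<^sub>R T u"
    and T_sym: "u \<in> X \<Longrightarrow> w \<in> X \<Longrightarrow> T u \<bullet> w = u \<bullet> T w"
begin

lemma diff_in: "u \<in> X \<Longrightarrow> w \<in> X \<Longrightarrow> u - w \<in> X"
  using add_in[of u "(-1) *\<^sub>R w"] scale_in[of w "-1"] by simp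

lemma T_diff: "u \<in> X \<Longrightarrow> w \<in> X \<Longrightarrow> T (u - w) = T u - T w"
  using T_add[of u "(-1) *\<^sub>R w"] scale_in[of w "-1"] T_scale[of w "-1"] by simp

definition res :: "real \<Rightarrow> 'a \<Rightarrow> 'a" where
  "res c = inv_into X (\<lambda>u. T u - c *\<^sub>R u)"

context
  fixes c assumes reg: "regular_point T X c"
begin

lemma res_in: "res c y \<in> X"
  and res_right: "T (res c y) = y + c *\<^sub>R res c y"
proof -
  have "y \<in> (\<lambda>u. T u - c *\<^sub>R u) ` X"
    using reg by (simp add: regular_point_def bij_betw_def)
  then show "res c y \<in> X" "T (res c y) = y + c *\<^sub>R res c y"
    using inv_into_into[of y "\<lambda>u. T u - c *\<^sub>R u" X] f_inv_into_f[of y "\<lambda>u. T u - c *\<^sub>R u" X]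
    by (simp_all add: res_def diff_eq_eq)
qed

lemma res_eqI: "u \<in> X \<Longrightarrow> T u - c *\<^sub>R u = y \<Longrightarrow> res c y = u"
  using reg inv_into_f_f[of "\<lambda>u. T u - c *\<^sub>R u" X u] by (simp add: res_def regular_point_def bij_betw_def)

lemma res_add: "res c (x + y) = res c x + res c y"
  by (rule res_eqI) (simp_all add: add_in res_in T_add res_right algebra_simps)

lemma res_scale: "res c (a *\<^sub>R x) = a *\<^sub>R res c x"
  by (rule res_eqI) (simp_all add: scale_in res_in T_scale res_right algebra_simps)

lemma res_sym: "res c x \<bullet> y = x \<bullet> res c y"
  using T_sym[of "res c x" "res c y"] by (simp add: res_in res_right inner_simps)

lemma bounded_linear_res: "bounded_linear (res c)"
proof -
  obtain C where C: "\<And>u. u \<in> X \<Longrightarrow> norm u \<le> C * norm (T u - c *\<^sub>R u)"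
    using reg by (auto simp: regular_point_def)
  show ?thesis
  proof (rule bounded_linear_intro)
    show "norm (res c x) \<le> norm x * C" for x
      using C[OF res_in, of x] by (simp add: res_right mult.commute)
  qed (simp_all add: res_add res_scale)
qed

end

lemma res_minus_bounded_below:
  assumes reg: "regular_point T X c" and k: "k \<noteq> 0" and reg': "regular_point T X (c + 1/k)"
  obtains C where "C > 0" "\<And>x. norm x \<le> C * norm (res c x - k *\<^sub>R x)"
proof -
  obtain C where C: "\<And>u. u \<in> X \<Longrightarrow> norm u \<le> C * norm (T u - (c + 1/k) *\<^sub>R u)"
    using reg' by (auto simp: regular_point_def)
  have "norm x \<le> ((1 + \<bar>C\<bar> / \<bar>k\<bar>) / \<bar>k\<bar>) * norm (res c x - k *\<^sub>R x)" for x
  proof -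
    define n where "n = norm (res c x - k *\<^sub>R x)"
    have "T (res c x) - (c + 1/k) *\<^sub>R res c x = (-1/k) *\<^sub>R (res c x - k *\<^sub>R x)"
      using k by (simp add: res_right[OF reg] algebra_simps)
    then have "norm (T (res c x) - (c + 1/k) *\<^sub>R res c x) = n / \<bar>k\<bar>"
      by (simp add: n_def)
    then have "norm (res c x) \<le> C * (n / \<bar>k\<bar>)"
      using C[OF res_in[OF reg, of x]] by simp
    also have "\<dots> \<le> \<bar>C\<bar> * (n / \<bar>k\<bar>)"
      by (intro mult_right_mono) (auto simp: n_def)
    finally have "norm (res c x) \<le> \<bar>C\<bar> * (n / \<bar>k\<bar>)" .
    moreover have "norm (k *\<^sub>R x) \<le> norm (res c x) + n"
      unfolding n_def by (metis add.commute norm_minus_commute norm_triangle_sub)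
    ultimately have "\<bar>k\<bar> * norm x \<le> (1 + \<bar>C\<bar> / \<bar>k\<bar>) * n"
      by (simp add: algebra_simps)
    then show ?thesis
      using k by (simp add: n_def pos_le_divide_eq mult.commute)
  qed
  moreover have "(1 + \<bar>C\<bar> / \<bar>k\<bar>) / \<bar>k\<bar> > 0"
    using k by (simp add: add_pos_nonneg)
  ultimately show ?thesis using that by blast
qed

text \<open>If the norm \<open>k\<close> of the resolvent \<open>B\<close> exceeded \<open>1/r\<close>, then \<open>B\<^sup>2 - k\<^sup>2 = (B - k)(B + k)\<close>
  would be bounded below, contradicting the definition of \<open>k\<close>.\<close>

lemma norm_ge_of_regular:
  assumes r: "r > 0" and reg: "\<And>\<mu>. \<bar>\<mu> - c\<bar> < r \<Longrightarrow> regular_point T X \<mu>" and u: "u \<in> X"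
  shows "r * norm u \<le> norm (T u - c *\<^sub>R u)"
proof -
  have rc: "regular_point T X c" using reg[of c] r by simp
  define B where "B = res c"
  define k where "k = onorm B"
  have bl: "bounded_linear B" unfolding B_def by (rule bounded_linear_res[OF rc])
  interpret B: bounded_linear B by (rule bl)
  have Bk: "norm (B x) \<le> k * norm x" for x
    unfolding k_def using onorm[OF bl] .
  have k0: "k \<ge> 0" unfolding k_def by (rule onorm_pos_le[OF bl])
  have "k \<le> 1/r"
  proof (rule ccontr)
    assume "\<not> k \<le> 1/r"
    then have k: "k > 1/r" by simp
    then have kp: "k > 0" using r by (smt (verit) divide_pos_pos)
    have "1/k < r" using k kp r by (simp add: field_simps)
    then have "regular_point T X (c + 1/k)" "regular_point T X (c + 1/(-k))"
      using kp by (auto intro!: reg)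
    then obtain C1 C2 where C1: "C1 > 0" "\<And>x. norm x \<le> C1 * norm (B x - k *\<^sub>R x)"
      and C2: "C2 > 0" "\<And>x. norm x \<le> C2 * norm (B x - (-k) *\<^sub>R x)"
      unfolding B_def using res_minus_bounded_below[OF rc] kp
      by (metis neg_equal_0_iff_equal less_irrefl)
    define D where "D = 1 / (C1 * C2)"
    have D: "D > 0" using C1 C2 by (simp add: D_def)
    have low: "D * norm x \<le> norm (B (B x) - k\<^sup>2 *\<^sub>R x)" for x
    proof -
      have "norm x \<le> C1 * norm (B x - k *\<^sub>R x)" by (rule C1)
      also have "\<dots> \<le> C1 * (C2 * norm (B (B x - k *\<^sub>R x) - (-k) *\<^sub>R (B x - k *\<^sub>R x)))"
        using C1 C2 by (intro mult_left_mono) auto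
      also have "B (B x - k *\<^sub>R x) - (-k) *\<^sub>R (B x - k *\<^sub>R x) = B (B x) - k\<^sup>2 *\<^sub>R x"
        by (simp add: B.diff B.scaleR algebra_simps power2_eq_square)
      finally show ?thesis using C1 C2 by (simp add: D_def field_simps)
    qed
    have key: "(k * norm (B x))\<^sup>2 \<le> (k^4 - D\<^sup>2) * (norm x)\<^sup>2" for x
    proof -
      have "(D * norm x)\<^sup>2 \<le> (norm (B (B x) - k\<^sup>2 *\<^sub>R x))\<^sup>2"
        using low[of x] D by (intro power_mono) auto
      also have "\<dots> = (norm (B (B x)))\<^sup>2 - 2 * k\<^sup>2 * (norm (B x))\<^sup>2 + k^4 * (norm x)\<^sup>2"
        using res_sym[OF rc, of "B x" x] unfolding B_def[symmetric] power2_norm_eq_inner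
        by (simp add: inner_simps inner_commute power2_eq_square power4_eq_xxxx)
      also have "(norm (B (B x)))\<^sup>2 \<le> (k * norm (B x))\<^sup>2"
        using Bk[of "B x"] by (intro power_mono) auto
      finally show ?thesis
        by (simp add: power_mult_distrib algebra_simps)
    qed
    have "norm (B x) \<le> (sqrt (max 0 (k^4 - D\<^sup>2)) / k) * norm x" for x
    proof -
      let ?m = "max 0 (k^4 - D\<^sup>2)"
      have "(k * norm (B x))\<^sup>2 \<le> ?m * (norm x)\<^sup>2"
        using key[of x] by (rule order_trans) (intro mult_right_mono, auto)
      also have "\<dots> = (sqrt ?m * norm x)\<^sup>2"
        by (simp add: power_mult_distrib)
      finally have "k * norm (B x) \<le> sqrt ?m * norm x"
        by (rule power2_le_imp_le) simp
      then show ?thesis using kp by (simp add: field_simps)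
    qed
    then have "k \<le> sqrt (max 0 (k^4 - D\<^sup>2)) / k"
      unfolding k_def by (rule onorm_bound[rotated]) (use kp in \<open>simp add: k_def\<close>)
    then have "k\<^sup>2 \<le> sqrt (max 0 (k^4 - D\<^sup>2))"
      using kp by (simp add: field_simps power2_eq_square)
    then have "(k\<^sup>2)\<^sup>2 \<le> max 0 (k^4 - D\<^sup>2)"
      by (metis real_le_lsqrt real_sqrt_ge_0_iff max.cobounded1 real_sqrt_pow2 power_mono zero_le_power2)
    moreover have "(k\<^sup>2)\<^sup>2 = k^4" "k^4 > 0" "D\<^sup>2 > 0"
      using kp D by (auto simp: power_mult[symmetric])
    ultimately show False by (simp add: max_def split: if_splits)
  qed
  have "u = B (T u - c *\<^sub>R u)"
    unfolding B_def using res_eqI[OF rc u refl] by simp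
  then have "norm u \<le> k * norm (T u - c *\<^sub>R u)"
    using Bk by metis
  also have "\<dots> \<le> (1/r) * norm (T u - c *\<^sub>R u)"
    using \<open>k \<le> 1/r\<close> by (intro mult_right_mono) auto
  finally show ?thesis using r by (simp add: field_simps)
qed

lemma form_ge_of_regular:
  assumes reg: "\<And>\<mu>. \<mu> < lam \<Longrightarrow> regular_point T X \<mu>" and u: "u \<in> X"
  shows "lam * (u \<bullet> u) \<le> T u \<bullet> u"
proof (rule ccontr)
  define q where "q = lam * (u \<bullet> u) - T u \<bullet> u"
  define K where "K = T u \<bullet> T u"
  assume "\<not> ?thesis"
  then have q: "q > 0" by (simp add: q_def)
  define c where "c = min (lam - 1) (- (K + 1) / q)"
  have c: "c < lam" "c * q \<le> - (K + 1)"
  proof -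
    show "c < lam" by (simp add: c_def min_def)
    have "c \<le> - (K + 1) / q" by (simp add: c_def)
    then show "c * q \<le> - (K + 1)" using q by (simp add: field_simps)
  qed
  have "(lam - c) * norm u \<le> norm (T u - c *\<^sub>R u)"
    by (rule norm_ge_of_regular) (use c u in \<open>auto intro!: reg\<close>)
  then have "((lam - c) * norm u)\<^sup>2 \<le> (norm (T u - c *\<^sub>R u))\<^sup>2"
    using c by (intro power_mono) auto
  then have "(lam - c)\<^sup>2 * (u \<bullet> u) \<le> K - 2 * c * (T u \<bullet> u) + c\<^sup>2 * (u \<bullet> u)"
    unfolding power_mult_distrib power2_norm_eq_inner K_def
    by (simp add: inner_simps inner_commute power2_eq_square algebra_simps)
  then have "lam\<^sup>2 * (u \<bullet> u) \<le> K + 2 * (c * q)"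
    by (simp add: q_def power2_eq_square algebra_simps)
  moreover have "0 \<le> lam\<^sup>2 * (u \<bullet> u)" "K \<ge> 0" by (simp_all add: K_def)
  ultimately show False using c by linarith
qed

lemma form_Cauchy_Schwarz:
  assumes S: "\<And>u w c. u \<in> S \<Longrightarrow> w \<in> S \<Longrightarrow> u + c *\<^sub>R w \<in> S" and SX: "S \<subseteq> X"
    and pos: "\<And>u. u \<in> S \<Longrightarrow> c * (u \<bullet> u) \<le> T u \<bullet> u"
    and u: "u \<in> S" and w: "w \<in> S"
  shows "((T u - c *\<^sub>R u) \<bullet> w)\<^sup>2 \<le> ((T u - c *\<^sub>R u) \<bullet> u) * ((T w - c *\<^sub>R w) \<bullet> w)"
proof -
  let ?a = "(T w - c *\<^sub>R w) \<bullet> w" and ?b = "(T u - c *\<^sub>R u) \<bullet> w" and ?d = "(T u - c *\<^sub>R u) \<bullet> u"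
  have X: "u \<in> X" "w \<in> X" using u w SX by auto
  have quad: "0 \<le> ?d + 2 * s * ?b + s\<^sup>2 * ?a" for s
  proof -
    have "0 \<le> (T (u + s *\<^sub>R w) - c *\<^sub>R (u + s *\<^sub>R w)) \<bullet> (u + s *\<^sub>R w)"
      using pos[OF S[OF u w, of s]] by (simp add: inner_diff_left)
    also have "\<dots> = ?d + 2 * s * ?b + s\<^sup>2 * ?a"
      using X T_sym[OF X]
      by (simp add: T_add T_scale scale_in inner_simps inner_commute power2_eq_square algebra_simps)
    finally show ?thesis .
  qed
  have a: "?a \<ge> 0" using pos[OF w] by (simp add: inner_diff_left)
  show ?thesis
  proof (cases "?a = 0")
    case True
    have "?b = 0"
    proof (rule ccontr)
      assume b: "?b \<noteq> 0"
      show False using quad[of "- (?d + 1) / (2 * ?b)"] b True by (simp add: field_simps)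
    qed
    then show ?thesis using True by simp
  next
    case False
    then have a: "?a > 0" using a by simp
    have "0 \<le> ?a * (?d + 2 * (- ?b / ?a) * ?b + (- ?b / ?a)\<^sup>2 * ?a)"
      using quad[of "- ?b / ?a"] a by (intro mult_nonneg_nonneg) auto
    also have "\<dots> = ?a * ?d - ?b\<^sup>2"
      using a by (simp add: field_simps power2_eq_square)
    finally show ?thesis by (simp add: mult.commute)
  qed
qed

end

locale ground_gap = symmetric_operator T X
  for T :: "'a::{real_inner, complete_space} \<Rightarrow> 'a" and X +
  fixes lam b :: real and \<phi> :: 'a
  assumes phi_in: "\<phi> \<in> X" and norm_phi: "norm \<phi> = 1" and T_phi: "T \<phi> = lam *\<^sub>R \<phi>"
    and simple: "u \<in> X \<Longrightarrow> T u = lam *\<^sub>R u \<Longrightarrow> \<exists>c. u = c *\<^sub>R \<phi>"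
    and lam_b: "lam < b"
    and regular: "\<mu> \<le> b \<Longrightarrow> \<mu> \<noteq> lam \<Longrightarrow> regular_point T X \<mu>"
begin

lemma inner_phi: "\<phi> \<bullet> \<phi> = 1"
  using norm_phi by (simp add: norm_eq_1)

lemma bottom: "u \<in> X \<Longrightarrow> lam * (u \<bullet> u) \<le> T u \<bullet> u"
  using lam_b by (intro form_ge_of_regular regular) auto

lemma T_inner_phi: "u \<in> X \<Longrightarrow> T u \<bullet> \<phi> = lam * (u \<bullet> \<phi>)"
  using T_sym[OF _ phi_in] by (simp add: T_phi)

lemma res_inner_phi:
  assumes "regular_point T X c" "c \<noteq> lam" "y \<bullet> \<phi> = 0" shows "res c y \<bullet> \<phi> = 0"
  using T_inner_phi[OF res_in[OF assms(1)], of y] res_right[OF assms(1), of y] assms(2,3)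
  by (simp add: inner_simps)

text \<open>With \<open>B = (T - lam + 1)\<^sup>-\<^sup>1\<close> the inner products of \<open>B\<^sup>m g\<close> and \<open>B\<^sup>n g\<close> depend on \<open>m + n\<close> only
  and decrease, so \<open>B\<^sup>n g\<close> converges, and its limit is a fixed point of \<open>B\<close>.\<close>

lemma res_power_tendsto_0:
  assumes g: "g \<bullet> \<phi> = 0"
  shows "(\<lambda>n. (res (lam - 1) ^^ n) g) \<longlonglongrightarrow> 0"
proof -
  have rc: "regular_point T X (lam - 1)" using lam_b by (intro regular) auto
  define B where "B = res (lam - 1)"
  define x where "x n = (B ^^ n) g" for n
  define a where "a k = (B ^^ k) g \<bullet> g" for k
  interpret B: bounded_linear B unfolding B_def by (rule bounded_linear_res[OF rc])
  have sym: "B y \<bullet> z = y \<bullet> B z" for y z unfolding B_def by (rule res_sym[OF rc])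
  have low: "B y \<bullet> B y \<le> B y \<bullet> y" for y
  proof -
    have "y = T (B y) - (lam - 1) *\<^sub>R B y"
      unfolding B_def by (simp add: res_right[OF rc])
    then have "B y \<bullet> y = T (B y) \<bullet> B y - (lam - 1) * (B y \<bullet> B y)"
      by (metis inner_diff_left inner_scaleR_left inner_commute)
    moreover have "lam * (B y \<bullet> B y) \<le> T (B y) \<bullet> B y"
      unfolding B_def by (intro bottom res_in[OF rc])
    ultimately show ?thesis by (simp add: algebra_simps)
  qed
  have high: "B y \<bullet> y \<le> y \<bullet> y" for y
  proof -
    have "0 \<le> (B y - y) \<bullet> (B y - y)" by simp
    then show ?thesis using low[of y] by (simp add: inner_simps inner_commute)
  qed
  have xy: "x m \<bullet> x n = a (m + n)" for m n
  proof (induction n arbitrary: m)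
    case (Suc n)
    have "x m \<bullet> x (Suc n) = B (x m) \<bullet> x n" by (simp add: x_def sym)
    also have "\<dots> = x (Suc m) \<bullet> x n" by (simp add: x_def)
    finally show ?case using Suc by simp
  qed (simp add: x_def a_def)
  have adec: "a (Suc k) \<le> a k" for k
  proof (cases "even k")
    case True
    then obtain n where k: "k = n + n" by (metis evenE mult_2)
    have "a (Suc k) = B (x n) \<bullet> x n" using xy[of "Suc n" n] k by (simp add: x_def)
    then show ?thesis using high[of "x n"] xy[of n n] k by simp
  next
    case False
    then obtain n where k: "k = Suc n + n" by (metis oddE mult_2 add_Suc Suc_eq_plus1)
    have "a k = B (x n) \<bullet> x n" "a (Suc k) = B (x n) \<bullet> B (x n)"
      using xy[of "Suc n" n] xy[of "Suc n" "Suc n"] k by (simp_all add: x_def)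
    then show ?thesis using low[of "x n"] by simp
  qed
  have a_nonneg: "0 \<le> a k" for k
  proof -
    have "a (k + k) \<le> a k" by (rule lift_Suc_antimono_le[of a, OF adec]) simp
    moreover have "a (k + k) = x k \<bullet> x k" using xy[of k k] by simp
    ultimately show ?thesis by (metis inner_ge_zero order_trans)
  qed
  have "\<exists>L. a \<longlonglongrightarrow> L"
    using decseq_convergent[of a 0] adec a_nonneg by (metis decseq_SucI)
  then obtain L where L: "a \<longlonglongrightarrow> L" by blast
  have "Cauchy x"
  proof (rule CauchyI)
    fix e :: real assume e: "e > 0"
    then obtain N where N: "\<And>n. n \<ge> N \<Longrightarrow> \<bar>a n - L\<bar> < e\<^sup>2/4"
      using LIMSEQ_D[OF L, of "e\<^sup>2/4"] by auto
    have "norm (x m - x n) < e" if "m \<ge> N" "n \<ge> N" for m n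
    proof -
      have "(norm (x m - x n))\<^sup>2 = a (m + m) - 2 * a (m + n) + a (n + n)"
        unfolding power2_norm_eq_inner by (simp add: inner_simps xy add.commute)
      also have "\<dots> < e\<^sup>2"
        using N[of "m + m"] N[of "m + n"] N[of "n + n"] that by linarith
      finally show ?thesis by (rule power2_less_imp_less) (use e in simp)
    qed
    then show "\<exists>M. \<forall>m\<ge>M. \<forall>n\<ge>M. norm (x m - x n) < e" by blast
  qed
  then obtain v where v: "x \<longlonglongrightarrow> v"
    using Cauchy_convergent convergent_def by blast
  have "(\<lambda>n. x (Suc n)) \<longlonglongrightarrow> B v"
    using B.tendsto[OF v] by (simp add: x_def)
  then have Bv: "B v = v"
    using LIMSEQ_Suc[OF v] LIMSEQ_unique by blast
  then have "v \<in> X" "T v = lam *\<^sub>R v"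
    using res_in[OF rc, of v] res_right[OF rc, of v] unfolding B_def[symmetric]
    by (simp_all add: algebra_simps)
  then obtain c where c: "v = c *\<^sub>R \<phi>" using simple by blast
  have "x n \<bullet> \<phi> = 0" for n
    by (induction n) (simp_all add: x_def g B_def res_inner_phi[OF rc])
  then have "(\<lambda>n. 0) \<longlonglongrightarrow> v \<bullet> \<phi>"
    using tendsto_inner[OF v tendsto_const, of \<phi>] by simp
  then have "v \<bullet> \<phi> = 0" by (metis LIMSEQ_unique tendsto_const)
  then have "v = 0" using c by (simp add: inner_phi)
  then show ?thesis using v by (simp add: x_def[abs_def] B_def)
qed

lemma gap_range:
  assumes y: "y \<in> X" and u: "u \<in> X" "u = T y - lam *\<^sub>R y"
  shows "b * (u \<bullet> u) \<le> T u \<bullet> u"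
proof (cases "u = 0")
  case False
  define d where "d = b - lam"
  have d: "d > 0" using lam_b by (simp add: d_def)
  have "(d/2) * norm y \<le> norm (T y - (lam + d/2) *\<^sub>R y)"
    by (rule norm_ge_of_regular) (use y d in \<open>auto intro!: regular simp: d_def abs_if field_simps split: if_splits\<close>)
  then have "((d/2) * norm y)\<^sup>2 \<le> (norm (u - (d/2) *\<^sub>R y))\<^sup>2"
    using d by (intro power_mono) (auto simp: u(2) algebra_simps)
  then have 1: "d * (u \<bullet> y) \<le> u \<bullet> u"
    unfolding power_mult_distrib power2_norm_eq_inner
    by (simp add: inner_simps inner_commute power2_eq_square algebra_simps)
  have "((T y - lam *\<^sub>R y) \<bullet> u)\<^sup>2 \<le> ((T y - lam *\<^sub>R y) \<bullet> y) * ((T u - lam *\<^sub>R u) \<bullet> u)"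
    by (rule form_Cauchy_Schwarz[of X]) (auto simp: add_in scale_in bottom y u(1))
  then have 2: "(u \<bullet> u)\<^sup>2 \<le> (u \<bullet> y) * ((T u - lam *\<^sub>R u) \<bullet> u)"
    by (simp flip: u(2))
  have A: "0 \<le> (T u - lam *\<^sub>R u) \<bullet> u"
    using bottom[OF u(1)] by (simp add: inner_diff_left)
  have "d * (u \<bullet> u)\<^sup>2 \<le> d * ((u \<bullet> y) * ((T u - lam *\<^sub>R u) \<bullet> u))"
    using 2 d by simp
  also have "\<dots> = (d * (u \<bullet> y)) * ((T u - lam *\<^sub>R u) \<bullet> u)" by simp
  also have "\<dots> \<le> (u \<bullet> u) * ((T u - lam *\<^sub>R u) \<bullet> u)"
    using 1 A by (rule mult_right_mono)
  finally have "(u \<bullet> u) * (d * (u \<bullet> u)) \<le> (u \<bullet> u) * ((T u - lam *\<^sub>R u) \<bullet> u)"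
    by (simp add: power2_eq_square algebra_simps)
  then have "d * (u \<bullet> u) \<le> (T u - lam *\<^sub>R u) \<bullet> u"
    using False by simp
  then show ?thesis by (simp add: d_def inner_simps algebra_simps)
qed simp

lemma gap_weak:
  assumes u: "u \<in> X" and perp: "u \<bullet> \<phi> = 0"
  shows "b * (u \<bullet> u) \<le> T u \<bullet> u"
proof -
  have rc: "regular_point T X (lam - 1)" using lam_b by (intro regular) auto
  define B where "B = res (lam - 1)"
  interpret B: bounded_linear B unfolding B_def by (rule bounded_linear_res[OF rc])
  have Bn_in: "(B ^^ n) w \<in> X" if "w \<in> X" for n w
    using that by (cases n) (auto simp: B_def res_in[OF rc])
  have TB: "T (B w) = B (T w)" if "w \<in> X" for w
  proof -
    have "B (T w - (lam - 1) *\<^sub>R w) = w"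
      unfolding B_def by (rule res_eqI[OF rc that refl])
    then have "B (T w) = w + (lam - 1) *\<^sub>R B w"
      by (simp add: B.diff B.scaleR diff_eq_eq)
    then show ?thesis unfolding B_def by (simp add: res_right[OF rc])
  qed
  have TBn: "T ((B ^^ n) u) = (B ^^ n) (T u)" for n
    by (induction n) (simp_all add: TB Bn_in u)
  have ran: "\<exists>y\<in>X. u - (B ^^ n) u = T y - lam *\<^sub>R y" for n
  proof (induction n)
    case 0
    show ?case using zero_in T_scale[OF zero_in, of 0] by (intro bexI[of _ 0]) auto
  next
    case (Suc n)
    then obtain y where y: "y \<in> X" "u - (B ^^ n) u = T y - lam *\<^sub>R y" by blast
    let ?z = "B ((B ^^ n) u)"
    have z: "?z \<in> X" "T ?z = (B ^^ n) u + (lam - 1) *\<^sub>R ?z"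
      unfolding B_def by (rule res_in[OF rc], rule res_right[OF rc])
    have "u - (B ^^ Suc n) u = T (y + ?z) - lam *\<^sub>R (y + ?z)"
      using y z by (simp add: T_add algebra_simps)
    then show ?case using add_in[OF y(1) z(1)] by blast
  qed
  define w where "w n = u - (B ^^ n) u" for n
  have "b * (w n \<bullet> w n) \<le> T (w n) \<bullet> w n" for n
    using ran[of n] gap_range[OF _ _ ] diff_in[OF u Bn_in[OF u, of n]] unfolding w_def by blast
  moreover have w: "w \<longlonglongrightarrow> u"
    unfolding w_def using tendsto_diff[OF tendsto_const res_power_tendsto_0[OF perp], of u]
    by (simp add: B_def)
  moreover have "(\<lambda>n. T (w n)) \<longlonglongrightarrow> T u"
  proof -
    have "T u \<bullet> \<phi> = 0" using T_inner_phi[OF u] perp by simp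
    from tendsto_diff[OF tendsto_const res_power_tendsto_0[OF this], of "T u"]
    show ?thesis by (simp add: w_def T_diff u Bn_in TBn) (simp add: B_def)
  qed
  ultimately show ?thesis
    by (intro LIMSEQ_le[of "\<lambda>n. b * (w n \<bullet> w n)" _ "\<lambda>n. T (w n) \<bullet> w n"] tendsto_intros) auto
qed

lemma gap:
  obtains \<beta> where "\<beta> > b" "\<And>u. u \<in> X \<Longrightarrow> u \<bullet> \<phi> = 0 \<Longrightarrow> \<beta> * (u \<bullet> u) \<le> T u \<bullet> u"
proof -
  have rb: "regular_point T X b" using lam_b by (intro regular) auto
  define S where "S = {u \<in> X. u \<bullet> \<phi> = 0}"
  define k where "k = onorm (res b) + 1"
  have k: "k > 0"
    using onorm_pos_le[OF bounded_linear_res[OF rb]] by (simp add: k_def)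
  have resk: "norm (res b y) \<le> k * norm y" for y
    using onorm[OF bounded_linear_res[OF rb], of y] norm_ge_zero[of y]
    unfolding k_def distrib_right by linarith
  have "(b + 1/k) * (u \<bullet> u) \<le> T u \<bullet> u" if u: "u \<in> S" for u
  proof (cases "u = 0")
    case False
    have w: "res b u \<in> S"
      using u lam_b by (auto simp: S_def res_in[OF rb] res_inner_phi[OF rb])
    have "((T u - b *\<^sub>R u) \<bullet> res b u)\<^sup>2 \<le>
        ((T u - b *\<^sub>R u) \<bullet> u) * ((T (res b u) - b *\<^sub>R res b u) \<bullet> res b u)"
      by (rule form_Cauchy_Schwarz[of S]) (use u w in \<open>auto simp: S_def add_in scale_in inner_simps gap_weak\<close>)
    moreover have "(T u - b *\<^sub>R u) \<bullet> res b u = u \<bullet> u"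
      using T_sym[of u "res b u"] u res_in[OF rb] by (simp add: res_right[OF rb] S_def inner_simps)
    moreover have "(T (res b u) - b *\<^sub>R res b u) \<bullet> res b u \<le> k * (u \<bullet> u)"
    proof -
      have "u \<bullet> res b u \<le> norm u * norm (res b u)" by (rule norm_cauchy_schwarz)
      also have "\<dots> \<le> norm u * (k * norm u)" by (intro mult_left_mono resk) auto
      finally show ?thesis by (simp add: res_right[OF rb] power2_norm_eq_inner[symmetric] power2_eq_square algebra_simps)
    qed
    moreover have "0 \<le> (T u - b *\<^sub>R u) \<bullet> u"
      using gap_weak[of u] u by (simp add: S_def inner_diff_left)
    ultimately have "(u \<bullet> u)\<^sup>2 \<le> ((T u - b *\<^sub>R u) \<bullet> u) * (k * (u \<bullet> u))"
      by (metis mult_left_mono order_trans)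
    then have "(u \<bullet> u) * (u \<bullet> u) \<le> (u \<bullet> u) * (k * ((T u - b *\<^sub>R u) \<bullet> u))"
      by (simp add: power2_eq_square algebra_simps)
    then have "u \<bullet> u \<le> k * ((T u - b *\<^sub>R u) \<bullet> u)" using False by simp
    then show ?thesis using k by (simp add: inner_simps field_simps)
  qed (use zero_in in simp)
  then show ?thesis using that[of "b + 1/k"] k by (simp add: S_def)
qed

end

section \<open>Fibers and the height along them\<close>

locale sheet = ground_gap T X lam b \<phi>
  for T :: "'a::{real_inner, complete_space} \<Rightarrow> 'a" and X lam b \<phi> +
  fixes \<beta> \<gamma> r :: real
  assumes form_gap: "u \<in> X \<Longrightarrow> u \<bullet> \<phi> = 0 \<Longrightarrow> \<beta> * (u \<bullet> u) \<le> T u \<bullet> u"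
    and r_nonneg: "0 \<le> r" and gamma_r: "\<gamma> + r < \<beta>" and gamma_b: "\<gamma> \<le> b" and gamma_lam: "\<gamma> \<noteq> lam"
begin

definition proj :: "'a \<Rightarrow> 'a" where
  "proj y = y - (y \<bullet> \<phi>) *\<^sub>R \<phi>"

lemma proj_inner [simp]: "proj y \<bullet> \<phi> = 0"
  by (simp add: proj_def inner_simps inner_phi)

lemma proj_add: "proj (x + y) = proj x + proj y"
  and proj_diff: "proj (x - y) = proj x - proj y"
  and proj_scaleR: "proj (c *\<^sub>R x) = c *\<^sub>R proj x"
  and proj_phi: "proj \<phi> = 0"
  by (simp_all add: proj_def inner_simps inner_phi algebra_simps)

lemma proj_idem: "y \<bullet> \<phi> = 0 \<Longrightarrow> proj y = y"
  by (simp add: proj_def)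

lemma norm_proj_le: "norm (proj y) \<le> norm y"
proof -
  have "(norm (proj y))\<^sup>2 = (norm y)\<^sup>2 - (y \<bullet> \<phi>)\<^sup>2"
    unfolding power2_norm_eq_inner proj_def
    by (simp add: inner_diff_left inner_diff_right inner_phi inner_commute power2_eq_square)
  then have "(norm (proj y))\<^sup>2 \<le> (norm y)\<^sup>2" by simp
  then show ?thesis by (rule power2_le_imp_le) simp
qed

lemma bounded_linear_proj: "bounded_linear proj"
  by (rule bounded_linear_intro[of _ 1]) (simp_all add: proj_add proj_scaleR norm_proj_le)

definition near_gamma :: "('a \<Rightarrow> 'a) \<Rightarrow> bool" where
  "near_gamma N \<longleftrightarrow> (\<forall>u w. norm (N u - N w - \<gamma> *\<^sub>R (u - w)) \<le> r * norm (u - w))"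

lemma near_gammaD: "near_gamma N \<Longrightarrow> norm (N u - N w - \<gamma> *\<^sub>R (u - w)) \<le> r * norm (u - w)"
  by (simp add: near_gamma_def)

lemma near_gamma_lipschitz:
  assumes "near_gamma N" shows "norm (N u - N w) \<le> (\<bar>\<gamma>\<bar> + r) * norm (u - w)"
proof -
  have "norm (N u - N w) \<le> norm (N u - N w - \<gamma> *\<^sub>R (u - w)) + norm (\<gamma> *\<^sub>R (u - w))"
    by (metis diff_add_cancel norm_triangle_ineq)
  then show ?thesis
    using near_gammaD[OF assms, of u w] unfolding norm_scaleR distrib_right by linarith
qed

lemma coercive:
  assumes "h \<in> X" "h \<bullet> \<phi> = 0" shows "(\<beta> - \<gamma>) * norm h \<le> norm (T h - \<gamma> *\<^sub>R h)"
proof (cases "h = 0")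
  case False
  have "(\<beta> - \<gamma>) * (norm h * norm h) \<le> (T h - \<gamma> *\<^sub>R h) \<bullet> h"
    using form_gap[OF assms] by (simp add: inner_simps algebra_simps dot_square_norm power2_eq_square)
  also have "\<dots> \<le> norm (T h - \<gamma> *\<^sub>R h) * norm h" by (rule norm_cauchy_schwarz)
  finally show ?thesis using False by (simp add: mult.assoc[symmetric])
qed simp

definition fib_const :: real where
  "fib_const = 1 + (1 + r) / (\<beta> - \<gamma> - r)"

lemma fib_const_pos: "fib_const > 0"
  using r_nonneg gamma_r by (simp add: fib_const_def add_pos_nonneg)

lemma fib_estimate:
  assumes N: "near_gamma N" and u: "u \<in> X" and w: "w \<in> X"
  shows "norm (u - w) \<le>
    fib_const * (norm (proj (T u - N u) - proj (T w - N w)) + \<bar>(u - w) \<bullet> \<phi>\<bar>)"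
proof -
  define s where "s = (u - w) \<bullet> \<phi>"
  define h where "h = u - w - s *\<^sub>R \<phi>"
  define \<zeta> where "\<zeta> = proj (T u - N u) - proj (T w - N w)"
  have h: "h \<in> X" "h \<bullet> \<phi> = 0"
    by (auto simp: h_def s_def diff_in u w scale_in phi_in inner_simps inner_phi)
  have k: "\<beta> - \<gamma> - r > 0" using gamma_r by simp
  have uw: "norm (u - w) \<le> norm h + \<bar>s\<bar>"
  proof -
    have "norm (u - w) = norm (h + s *\<^sub>R \<phi>)" by (simp add: h_def)
    also have "\<dots> \<le> norm h + norm (s *\<^sub>R \<phi>)" by (rule norm_triangle_ineq)
    finally show ?thesis by (simp add: norm_phi)
  qed
  have Th: "T h = T u - T w - (s * lam) *\<^sub>R \<phi>"
    by (simp add: h_def T_diff diff_in u w scale_in phi_in T_scale T_phi)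
  define g where "g = (T u - N u) - (T w - N w) + (N u - N w - \<gamma> *\<^sub>R (u - w))
      - (s * lam - s * \<gamma>) *\<^sub>R \<phi>"
  have g: "T h - \<gamma> *\<^sub>R h = g"
    unfolding Th g_def by (simp add: h_def algebra_simps)
  have "T h - \<gamma> *\<^sub>R h = proj (T h - \<gamma> *\<^sub>R h)"
    using h T_inner_phi[OF h(1)] by (intro proj_idem[symmetric]) (simp add: inner_simps)
  also have "\<dots> = \<zeta> + proj (N u - N w - \<gamma> *\<^sub>R (u - w))"
    unfolding g g_def \<zeta>_def proj_diff proj_add proj_scaleR proj_phi by simp
  finally have "norm (T h - \<gamma> *\<^sub>R h) \<le> norm \<zeta> + norm (proj (N u - N w - \<gamma> *\<^sub>R (u - w)))"
    by (simp add: norm_triangle_ineq)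
  also have "\<dots> \<le> norm \<zeta> + r * norm (u - w)"
    using norm_proj_le near_gammaD[OF N] by (smt (verit))
  also have "\<dots> \<le> norm \<zeta> + r * (norm h + \<bar>s\<bar>)"
    using uw r_nonneg by (simp add: mult_left_mono)
  finally have "(\<beta> - \<gamma> - r) * norm h \<le> norm \<zeta> + r * \<bar>s\<bar>"
    using coercive[OF h] by (simp add: algebra_simps)
  also have "\<dots> \<le> (1 + r) * (norm \<zeta> + \<bar>s\<bar>)"
    using r_nonneg by (simp add: algebra_simps)
  finally have "norm h \<le> (1 + r) / (\<beta> - \<gamma> - r) * (norm \<zeta> + \<bar>s\<bar>)"
    using k by (simp add: field_simps)
  also have "\<dots> = (fib_const - 1) * (norm \<zeta> + \<bar>s\<bar>)" by (simp add: fib_const_def)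
  finally have "norm h \<le> (fib_const - 1) * (norm \<zeta> + \<bar>s\<bar>)" .
  then have "norm (u - w) \<le> fib_const * (norm \<zeta> + \<bar>s\<bar>)"
  proof -
    have "x \<le> c * (y + q)" if "x \<le> p + q" "p \<le> (c - 1) * (y + q)" "0 \<le> y" for x p q c y :: real
      using that by (simp add: algebra_simps)
    then show ?thesis using uw \<open>norm h \<le> (fib_const - 1) * (norm \<zeta> + \<bar>s\<bar>)\<close> by simp
  qed
  then show ?thesis by (simp add: \<zeta>_def s_def)
qed

lemma fib_exists:
  assumes N: "near_gamma N" and z: "z \<bullet> \<phi> = 0"
  shows "\<exists>u\<in>X. u \<bullet> \<phi> = t \<and> proj (T u - N u) = z"
proof -
  have reg: "regular_point T X \<gamma>" using gamma_b gamma_lam by (rule regular)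
  interpret R: bounded_linear "res \<gamma>" by (rule bounded_linear_res[OF reg])
  define \<Psi> where "\<Psi> u = res \<gamma> (z + proj (N u - \<gamma> *\<^sub>R u) + ((lam - \<gamma>) * t) *\<^sub>R \<phi>)" for u
  have "\<exists>!u. \<Psi> u = u"
  proof (rule banach_fix_type[of "r / (\<beta> - \<gamma>)"])
    show "0 \<le> r / (\<beta> - \<gamma>)" "r / (\<beta> - \<gamma>) < 1"
      using r_nonneg gamma_r by (auto simp: field_simps)
    have "dist (\<Psi> u) (\<Psi> w) \<le> r / (\<beta> - \<gamma>) * dist u w" for u w
    proof -
      let ?y = "proj (N u - N w - \<gamma> *\<^sub>R (u - w))"
      have eq: "\<Psi> u - \<Psi> w = res \<gamma> ?y"
        unfolding \<Psi>_def R.diff[symmetric] proj_diff proj_scaleR scaleR_diff_right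
        by (intro arg_cong[where f = "res \<gamma>"]) simp
      have "(\<beta> - \<gamma>) * norm (res \<gamma> ?y) \<le> norm (T (res \<gamma> ?y) - \<gamma> *\<^sub>R res \<gamma> ?y)"
        by (rule coercive) (auto simp: res_in[OF reg] res_inner_phi[OF reg gamma_lam])
      also have "\<dots> = norm ?y" by (simp add: res_right[OF reg])
      also have "\<dots> \<le> r * norm (u - w)"
        using norm_proj_le near_gammaD[OF N] by (rule order_trans)
      finally show ?thesis
        using gamma_r r_nonneg by (simp add: eq dist_norm field_simps)
    qed
    then show "\<forall>u w. dist (\<Psi> u) (\<Psi> w) \<le> r / (\<beta> - \<gamma>) * dist u w" by blast
  qed
  then obtain u where u: "\<Psi> u = u" by blast
  have uX: "u \<in> X" using u res_in[OF reg] unfolding \<Psi>_def by metis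
  have Tu: "T u = z + proj (N u - \<gamma> *\<^sub>R u) + ((lam - \<gamma>) * t) *\<^sub>R \<phi> + \<gamma> *\<^sub>R u"
    using u res_right[OF reg] unfolding \<Psi>_def by metis
  then have "T u \<bullet> \<phi> = (z + proj (N u - \<gamma> *\<^sub>R u) + ((lam - \<gamma>) * t) *\<^sub>R \<phi> + \<gamma> *\<^sub>R u) \<bullet> \<phi>"
    by simp
  then have "lam * (u \<bullet> \<phi>) = (lam - \<gamma>) * t + \<gamma> * (u \<bullet> \<phi>)"
    using z by (simp add: T_inner_phi[OF uX] inner_add_left inner_phi)
  then have "(lam - \<gamma>) * (u \<bullet> \<phi>) = (lam - \<gamma>) * t" by (simp add: algebra_simps)
  then have t: "u \<bullet> \<phi> = t" using gamma_lam by simp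
  have "proj (T u) = proj (z + proj (N u - \<gamma> *\<^sub>R u) + ((lam - \<gamma>) * t) *\<^sub>R \<phi> + \<gamma> *\<^sub>R u)"
    using Tu by (rule arg_cong)
  also have "\<dots> = z + proj (N u)"
    by (simp add: proj_add proj_scaleR proj_phi proj_idem[OF z] proj_idem[of "proj _"] proj_diff)
  finally have "proj (T u - N u) = z" by (simp add: proj_diff)
  then show ?thesis using uX t by blast
qed

end

locale fold_map = sheet T X lam b \<phi> \<beta> \<gamma> r
  for T :: "'a::{real_inner, complete_space} \<Rightarrow> 'a" and X lam b \<phi> \<beta> \<gamma> r +
  fixes N :: "'a \<Rightarrow> 'a" and D :: "'a \<Rightarrow> 'a \<Rightarrow> 'a" and a :: real
  assumes a_lam: "a < lam"
    and N_near: "near_gamma N"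
    and N_top: "((\<lambda>t. (1/t) *\<^sub>R N (t *\<^sub>R \<phi>)) \<longlongrightarrow> b *\<^sub>R \<phi>) at_top"
    and N_bot: "((\<lambda>t. (1/t) *\<^sub>R N (t *\<^sub>R \<phi>)) \<longlongrightarrow> a *\<^sub>R \<phi>) at_bot"
    and D_near: "near_gamma (D u)"
    and D_linear: "linear (D u)"
    and D_sym: "D u x \<bullet> y = x \<bullet> D u y"
    and D_deriv: "((\<lambda>s. (1/s) *\<^sub>R (N (u + s *\<^sub>R h) - N u)) \<longlongrightarrow> D u h) (at 0)"
    and kernel: "u \<in> X \<Longrightarrow> p \<in> X \<Longrightarrow> p \<noteq> 0 \<Longrightarrow> T p = D u p \<Longrightarrow>
      \<exists>\<psi> \<mu>. \<psi> \<in> X \<and> \<psi> \<noteq> 0 \<and> \<mu> \<le> 0 \<and> T \<psi> - D u \<psi> = \<mu> *\<^sub>R \<psi> \<and> (\<mu> = 0 \<longrightarrow> (\<exists>c. p = c *\<^sub>R \<psi>)) \<and>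
        0 \<le> \<psi> \<bullet> \<phi> \<and> (\<forall>w. w \<noteq> u \<longrightarrow> 0 < (N w - N u - D u (w - u)) \<bullet> \<psi>)"
begin

definition fib :: "'a \<Rightarrow> real \<Rightarrow> 'a" where
  "fib z t = (SOME u. u \<in> X \<and> u \<bullet> \<phi> = t \<and> proj (T u - N u) = z)"

definition height :: "'a \<Rightarrow> real \<Rightarrow> real" where
  "height z t = (T (fib z t) - N (fib z t)) \<bullet> \<phi>"

context
  fixes z assumes z: "z \<bullet> \<phi> = 0"
begin

lemma fib: "fib z t \<in> X" "fib z t \<bullet> \<phi> = t" "proj (T (fib z t) - N (fib z t)) = z"
proof -
  have "\<exists>u. u \<in> X \<and> u \<bullet> \<phi> = t \<and> proj (T u - N u) = z"
    using fib_exists[OF N_near z, of t] by blast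
  from someI_ex[OF this]
  show "fib z t \<in> X" "fib z t \<bullet> \<phi> = t" "proj (T (fib z t) - N (fib z t)) = z"
    by (auto simp: fib_def)
qed

lemma fib_close:
  assumes "w \<in> X" "w \<bullet> \<phi> = t"
  shows "norm (fib z t - w) \<le> fib_const * norm (z - proj (T w - N w))"
  using fib_estimate[OF N_near fib(1) assms(1), of t] assms(2) by (simp add: fib inner_simps)

lemma fib_eqI: "w \<in> X \<Longrightarrow> proj (T w - N w) = z \<Longrightarrow> w \<bullet> \<phi> = t \<Longrightarrow> fib z t = w"
  using fib_close[of w t] by simp

lemma height_eq: "height z t = lam * t - N (fib z t) \<bullet> \<phi>"
  by (simp add: height_def inner_diff_left T_inner_phi fib)

lemma height_decomp: "T (fib z t) - N (fib z t) = z + height z t *\<^sub>R \<phi>"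
  using fib(3)[of t] by (simp add: proj_def height_def algebra_simps)

lemma DERIV_height:
  assumes p: "p \<in> X" "p \<bullet> \<phi> = 1" "proj (T p - D (fib z t) p) = 0"
  shows "DERIV (height z) t :> (T p - D (fib z t) p) \<bullet> \<phi>"
proof -
  define u where "u = fib z t"
  define \<kappa> where "\<kappa> = (T p - D u p) \<bullet> \<phi>"
  define e where "e s = N (u + s *\<^sub>R p) - N u - s *\<^sub>R D u p" for s
  define K where "K = (\<bar>\<gamma>\<bar> + r) * fib_const + 1"
  have bound: "\<bar>height z (t + s) - height z t - s * \<kappa>\<bar> \<le> K * norm (e s)" for s
  proof -
    define w where "w = u + s *\<^sub>R p"
    have w: "w \<in> X" "w \<bullet> \<phi> = t + s"
      using p fib[of t] by (auto simp: w_def u_def inner_simps add_in scale_in)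
    have "T w - N w = (T u - N u) + s *\<^sub>R (T p - D u p) - e s"
      using p(1) fib(1)[of t] unfolding w_def e_def u_def
      by (simp add: T_add T_scale scale_in algebra_simps)
    then have "proj (T w - N w) = proj (T u - N u) + s *\<^sub>R proj (T p - D u p) - proj (e s)"
      by (simp add: proj_add proj_diff proj_scaleR)
    then have "proj (T w - N w) = z - proj (e s)"
      using p(3) fib(3)[of t] by (simp add: u_def)
    then have "norm (fib z (t + s) - w) \<le> fib_const * norm (proj (e s))"
      using fib_close[OF w] by simp
    also have "\<dots> \<le> fib_const * norm (e s)"
      using fib_const_pos by (simp add: norm_proj_le)
    finally have "(\<bar>\<gamma>\<bar> + r) * norm (fib z (t + s) - w) \<le> (\<bar>\<gamma>\<bar> + r) * (fib_const * norm (e s))"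
      using r_nonneg by (intro mult_left_mono) auto
    with near_gamma_lipschitz[OF N_near, of "fib z (t + s)" w]
    have 1: "norm (N (fib z (t + s)) - N w) \<le> (\<bar>\<gamma>\<bar> + r) * (fib_const * norm (e s))"
      by linarith
    have kap: "\<kappa> = lam - D u p \<bullet> \<phi>"
      using T_inner_phi[OF p(1)] p(2) by (simp add: \<kappa>_def inner_diff_left)
    then have "height z (t + s) - height z t - s * \<kappa> = - ((N (fib z (t + s)) - N w + e s) \<bullet> \<phi>)"
      unfolding height_eq e_def w_def u_def kap by (simp add: inner_simps algebra_simps)
    then have "\<bar>height z (t + s) - height z t - s * \<kappa>\<bar> \<le> norm (N (fib z (t + s)) - N w + e s) * norm \<phi>"
      by (metis Cauchy_Schwarz_ineq2 abs_minus_cancel)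
    also have "\<dots> \<le> norm (N (fib z (t + s)) - N w) + norm (e s)"
      by (simp add: norm_phi norm_triangle_ineq)
    also have "\<dots> \<le> K * norm (e s)"
      using 1 by (simp add: K_def algebra_simps)
    finally show ?thesis .
  qed
  have "((\<lambda>s. (1/s) *\<^sub>R (N (u + s *\<^sub>R p) - N u) - D u p) \<longlongrightarrow> 0) (at 0)"
    using tendsto_diff[OF D_deriv[of u p] tendsto_const, of "D u p"] by simp
  then have lim: "((\<lambda>s. K * norm ((1/s) *\<^sub>R (N (u + s *\<^sub>R p) - N u) - D u p)) \<longlongrightarrow> 0) (at 0)"
    using tendsto_mult_right_zero tendsto_norm_zero by blast
  have "((\<lambda>s. (height z (t + s) - height z t) / s - \<kappa>) \<longlongrightarrow> 0) (at 0)"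
  proof (rule Lim_null_comparison[OF _ lim])
    have "norm ((height z (t + s) - height z t) / s - \<kappa>)
        \<le> K * norm ((1/s) *\<^sub>R (N (u + s *\<^sub>R p) - N u) - D u p)" if s: "s \<noteq> 0" for s
    proof -
      have "norm ((height z (t + s) - height z t) / s - \<kappa>)
          = \<bar>height z (t + s) - height z t - s * \<kappa>\<bar> / \<bar>s\<bar>"
        using s by (simp add: abs_divide[symmetric] diff_divide_distrib)
      also have "\<dots> \<le> K * norm (e s) / \<bar>s\<bar>"
        by (intro divide_right_mono bound) simp
      also have "\<dots> = K * norm ((1/s) *\<^sub>R e s)" by simp
      also have "(1/s) *\<^sub>R e s = (1/s) *\<^sub>R (N (u + s *\<^sub>R p) - N u) - D u p"
        using s by (simp add: e_def scaleR_diff_right)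
      finally show ?thesis .
    qed
    then show "\<forall>\<^sub>F s in at 0. norm ((height z (t + s) - height z t) / s - \<kappa>)
        \<le> K * norm ((1/s) *\<^sub>R (N (u + s *\<^sub>R p) - N u) - D u p)"
      by (auto simp: eventually_at_filter)
  qed
  then have "DERIV (height z) t :> \<kappa>"
    unfolding DERIV_def by (rule LIM_zero_cancel)
  then show ?thesis by (simp add: \<kappa>_def u_def)
qed

text \<open>At a critical point of \<open>height z\<close> the tangent \<open>p\<close> of the fiber spans the kernel of \<open>T - D u\<close>.
  The form of \<open>T - D u\<close> is positive on the complement of \<open>\<phi>\<close>, which leaves no room for a second
  nonpositive eigenvalue, so \<open>p\<close> is a ground state; testing with it and using convexity shows that
  the critical point is a strict global maximum.\<close>

lemma critical_is_strict_max:
  assumes p: "p \<in> X" "p \<bullet> \<phi> = 1" "proj (T p - D (fib z t) p) = 0"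
    and crit: "(T p - D (fib z t) p) \<bullet> \<phi> = 0" and st: "s \<noteq> t"
  shows "height z s < height z t"
proof -
  define u where "u = fib z t"
  define w where "w = fib z s"
  have X: "u \<in> X" "w \<in> X" by (simp_all add: u_def w_def fib)
  interpret D: linear "D u" by (rule D_linear)
  have Tp: "T p = D u p" using p(3) crit by (simp add: proj_def u_def)
  have p0: "p \<noteq> 0" using p(2) by auto
  obtain \<psi> \<mu> where \<psi>: "\<psi> \<in> X" "\<psi> \<noteq> 0" "\<mu> \<le> 0" "T \<psi> - D u \<psi> = \<mu> *\<^sub>R \<psi>"
      "\<mu> = 0 \<Longrightarrow> \<exists>c. p = c *\<^sub>R \<psi>" "0 \<le> \<psi> \<bullet> \<phi>"
      "\<And>w. w \<noteq> u \<Longrightarrow> 0 < (N w - N u - D u (w - u)) \<bullet> \<psi>"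
    using kernel[OF X(1) p(1) p0 Tp] by blast
  have form_pos: "0 < (T h - D u h) \<bullet> h" if h: "h \<in> X" "h \<bullet> \<phi> = 0" "h \<noteq> 0" for h
  proof -
    have "D u h \<bullet> h - \<gamma> * (h \<bullet> h) = (D u h - D u 0 - \<gamma> *\<^sub>R (h - 0)) \<bullet> h"
      by (simp add: D.zero inner_simps)
    also have "\<dots> \<le> norm (D u h - D u 0 - \<gamma> *\<^sub>R (h - 0)) * norm h"
      by (rule norm_cauchy_schwarz)
    also have "\<dots> \<le> r * norm (h - 0) * norm h"
      by (intro mult_right_mono near_gammaD[OF D_near]) auto
    also have "\<dots> = r * (h \<bullet> h)" by (simp add: dot_square_norm power2_eq_square)
    finally have "D u h \<bullet> h \<le> (\<gamma> + r) * (h \<bullet> h)" by (simp add: algebra_simps)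
    also have "\<dots> < \<beta> * (h \<bullet> h)" using gamma_r h(3) by simp
    also have "\<dots> \<le> T h \<bullet> h" by (rule form_gap[OF h(1,2)])
    finally show ?thesis by (simp add: inner_diff_left)
  qed
  have "\<mu> = 0"
  proof (rule ccontr)
    assume \<mu>: "\<mu> \<noteq> 0"
    have "\<mu> * (\<psi> \<bullet> p) = (T \<psi> - D u \<psi>) \<bullet> p" by (simp add: \<psi>(4))
    also have "\<dots> = \<psi> \<bullet> (T p - D u p)"
      by (simp add: inner_simps T_sym[OF \<psi>(1) p(1)] D_sym)
    finally have perp: "\<psi> \<bullet> p = 0" using Tp \<mu> by simp
    define c where "c = \<psi> \<bullet> \<phi>"
    define h where "h = \<psi> - c *\<^sub>R p"
    have h: "h \<in> X" "h \<bullet> \<phi> = 0"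
      using \<psi>(1) p by (auto simp: h_def c_def diff_in scale_in inner_simps)
    have "h \<bullet> \<psi> = \<psi> \<bullet> \<psi>" using perp by (simp add: h_def inner_simps inner_commute)
    then have "h \<noteq> 0" using \<psi>(2) by auto
    have "T h - D u h = (T \<psi> - D u \<psi>) - c *\<^sub>R (T p - D u p)"
      using \<psi>(1) p(1) by (simp add: h_def T_diff T_scale scale_in D.diff D.scale algebra_simps)
    then have "(T h - D u h) \<bullet> h = \<mu> * (\<psi> \<bullet> \<psi>)"
      using \<psi>(4) Tp perp by (simp add: h_def inner_simps)
    also have "\<dots> \<le> 0" using \<psi>(3) by (simp add: mult_nonpos_nonneg)
    finally show False using form_pos[OF h \<open>h \<noteq> 0\<close>] by simp
  qed
  then obtain c where c: "p = c *\<^sub>R \<psi>" using \<psi>(5) by blast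
  have "c * (\<psi> \<bullet> \<phi>) = 1" using p(2) c by simp
  then have "c > 0" using \<psi>(6) by (metis less_le mult_nonpos_nonneg not_le zero_less_one mult_zero_left linorder_not_less)
  have "w \<noteq> u" using st fib(2)[of s] fib(2)[of t] unfolding u_def w_def by auto
  then have "0 < (N w - N u - D u (w - u)) \<bullet> p"
    using \<psi>(7)[of w] \<open>c > 0\<close> by (simp add: c)
  also have "\<dots> = - ((T w - N w) - (T u - N u)) \<bullet> p"
  proof -
    have "D u (w - u) \<bullet> p = (T w - T u) \<bullet> p"
      using T_sym[OF diff_in[OF X(2,1)] p(1)] D_sym[of u "w - u" p] Tp T_diff[OF X(2,1)] by simp
    then show ?thesis by (simp add: inner_simps)
  qed
  also have "\<dots> = height z t - height z s"
    using p(2) unfolding u_def w_def height_decomp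
    by (simp add: inner_simps inner_commute)
  finally show ?thesis by simp
qed

lemma DERIV_height_ex:
  obtains k where "DERIV (height z) t :> k" "k = 0 \<Longrightarrow> \<forall>s. s \<noteq> t \<longrightarrow> height z s < height z t"
proof -
  obtain p where p: "p \<in> X" "p \<bullet> \<phi> = 1" "proj (T p - D (fib z t) p) = 0"
    using fib_exists[OF D_near, of 0 1 "fib z t"] by auto
  show ?thesis
    using that[OF DERIV_height[OF p]] critical_is_strict_max[OF p] by blast
qed

lemma height_quasiconcave:
  assumes "t1 < t2" "t2 < t3"
  shows "min (height z t1) (height z t3) < height z t2"
proof (rule ccontr)
  assume "\<not> ?thesis"
  then have le: "height z t2 \<le> height z t1" "height z t2 \<le> height z t3" by auto
  have "continuous_on {t1..t3} (height z)"
    by (meson DERIV_height_ex DERIV_isCont continuous_at_imp_continuous_on)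
  then obtain m where m: "m \<in> {t1..t3}" "\<And>t. t \<in> {t1..t3} \<Longrightarrow> height z m \<le> height z t"
    using continuous_attains_inf[of "{t1..t3}" "height z"] assms by auto
  obtain m' where m': "m' \<in> {t1<..<t3}" "\<And>t. t \<in> {t1..t3} \<Longrightarrow> height z m' \<le> height z t"
  proof (cases "m = t1 \<or> m = t3")
    case True
    then show ?thesis using that[of t2] assms m le by fastforce
  next
    case False
    then show ?thesis using that[of m] m by auto
  qed
  obtain k where k: "DERIV (height z) m' :> k" "k = 0 \<Longrightarrow> \<forall>s. s \<noteq> m' \<longrightarrow> height z s < height z m'"
    using DERIV_height_ex by blast
  have "k = 0"
  proof (rule DERIV_local_min[OF k(1)])
    show "0 < min (m' - t1) (t3 - m')" using m'(1) by auto
    show "\<forall>y. \<bar>m' - y\<bar> < min (m' - t1) (t3 - m') \<longrightarrow> height z m' \<le> height z y"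
      using m'(2) by (auto simp: abs_less_iff)
  qed
  then have "height z t1 < height z m'" using k(2) m'(1) by auto
  then show False using m'(2)[of t1] assms by simp
qed

lemma height_div_tendsto:
  assumes lim: "((\<lambda>t. (1/t) *\<^sub>R N (t *\<^sub>R \<phi>)) \<longlongrightarrow> c *\<^sub>R \<phi>) F"
    and inv: "((\<lambda>t. 1/t) \<longlongrightarrow> 0) F" and ne: "\<forall>\<^sub>F t in F. t \<noteq> 0"
  shows "((\<lambda>t. height z t / t) \<longlongrightarrow> lam - c) F"
proof -
  define n where "n t = (1/t) *\<^sub>R N (t *\<^sub>R \<phi>)" for t
  define K where "K = (\<bar>\<gamma>\<bar> + r) * fib_const"
  have n: "(n \<longlongrightarrow> c *\<^sub>R \<phi>) F" using lim by (simp add: n_def[abs_def])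
  have "((\<lambda>t. lam - n t \<bullet> \<phi>) \<longlongrightarrow> lam - (c *\<^sub>R \<phi>) \<bullet> \<phi>) F"
    by (intro tendsto_intros n)
  then have main: "((\<lambda>t. lam - n t \<bullet> \<phi>) \<longlongrightarrow> lam - c) F" by (simp add: inner_phi)
  have "((\<lambda>t. K * norm ((1/t) *\<^sub>R z + proj (n t))) \<longlongrightarrow> K * norm (0 *\<^sub>R z + proj (c *\<^sub>R \<phi>))) F"
    by (intro tendsto_intros inv bounded_linear.tendsto[OF bounded_linear_proj n])
  then have null: "((\<lambda>t. K * norm ((1/t) *\<^sub>R z + proj (n t))) \<longlongrightarrow> 0) F"
    by (simp add: proj_scaleR proj_phi)
  have "((\<lambda>t. height z t / t - (lam - n t \<bullet> \<phi>)) \<longlongrightarrow> 0) F"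
  proof (rule Lim_null_comparison[OF _ null])
    show "\<forall>\<^sub>F t in F. norm (height z t / t - (lam - n t \<bullet> \<phi>)) \<le> K * norm ((1/t) *\<^sub>R z + proj (n t))"
      using ne
    proof eventually_elim
      case (elim t)
      have tp: "t *\<^sub>R \<phi> \<in> X" "(t *\<^sub>R \<phi>) \<bullet> \<phi> = t" "N (t *\<^sub>R \<phi>) = t *\<^sub>R n t"
        using elim by (simp_all add: scale_in phi_in inner_phi n_def)
      have "norm (fib z t - t *\<^sub>R \<phi>) \<le> fib_const * norm (z - proj (T (t *\<^sub>R \<phi>) - N (t *\<^sub>R \<phi>)))"
        by (rule fib_close[OF tp(1,2)])
      also have "z - proj (T (t *\<^sub>R \<phi>) - N (t *\<^sub>R \<phi>)) = t *\<^sub>R ((1/t) *\<^sub>R z + proj (n t))"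
        using elim by (simp add: tp(3) T_scale phi_in T_phi proj_diff proj_scaleR proj_phi scaleR_add_right)
      finally have "(\<bar>\<gamma>\<bar> + r) * norm (fib z t - t *\<^sub>R \<phi>)
          \<le> (\<bar>\<gamma>\<bar> + r) * (fib_const * norm (t *\<^sub>R ((1/t) *\<^sub>R z + proj (n t))))"
        using r_nonneg by (intro mult_left_mono) auto
      with near_gamma_lipschitz[OF N_near, of "fib z t" "t *\<^sub>R \<phi>"]
      have 1: "norm (N (fib z t) - N (t *\<^sub>R \<phi>)) \<le> \<bar>t\<bar> * (K * norm ((1/t) *\<^sub>R z + proj (n t)))"
        unfolding norm_scaleR K_def mult.assoc mult.left_commute[of "\<bar>t\<bar>"] by linarith
      have "height z t / t - (lam - n t \<bullet> \<phi>) = - ((N (fib z t) - N (t *\<^sub>R \<phi>)) \<bullet> \<phi>) / t"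
        using elim by (simp add: height_eq tp(3) inner_simps field_simps)
      then have "norm (height z t / t - (lam - n t \<bullet> \<phi>)) = \<bar>(N (fib z t) - N (t *\<^sub>R \<phi>)) \<bullet> \<phi>\<bar> / \<bar>t\<bar>"
        by simp
      also have "\<dots> \<le> norm (N (fib z t) - N (t *\<^sub>R \<phi>)) / \<bar>t\<bar>"
        using Cauchy_Schwarz_ineq2[of "N (fib z t) - N (t *\<^sub>R \<phi>)" \<phi>]
        by (intro divide_right_mono) (simp_all add: norm_phi)
      also have "\<dots> \<le> K * norm ((1/t) *\<^sub>R z + proj (n t))"
        using 1 elim by (simp add: field_simps)
      finally show ?case .
    qed
  qed
  from tendsto_add[OF this main] show ?thesis by simp
qed

lemma height_at_top: "filterlim (height z) at_bot at_top"
proof -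
  have "((\<lambda>t. height z t / t) \<longlongrightarrow> lam - b) at_top"
    by (rule height_div_tendsto[OF N_top])
      (auto intro: real_tendsto_divide_at_top[OF tendsto_const filterlim_ident] eventually_at_top_not_equal)
  then have "LIM t at_top. height z t / t * t :> at_bot"
    using lam_b by (intro filterlim_tendsto_neg_mult_at_bot filterlim_ident) auto
  moreover have "\<forall>\<^sub>F t in at_top. height z t / t * t = height z t"
    using eventually_at_top_not_equal[of 0] by eventually_elim simp
  ultimately show ?thesis
    by (simp add: filterlim_cong[OF refl refl])
qed

lemma height_at_bot: "filterlim (height z) at_bot at_bot"
proof -
  have "((\<lambda>t. height z t / t) \<longlongrightarrow> lam - a) at_bot"
    by (rule height_div_tendsto[OF N_bot])
      (auto intro: tendsto_divide_0[OF tendsto_const filterlim_at_bot_imp_at_infinity[OF filterlim_ident]]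
        eventually_at_bot_not_equal)
  then have "LIM t at_bot. height z t / t * t :> at_bot"
    using a_lam by (intro filterlim_tendsto_pos_mult_at_bot filterlim_ident) auto
  moreover have "\<forall>\<^sub>F t in at_bot. height z t / t * t = height z t"
    using eventually_at_bot_not_equal[of 0] by eventually_elim simp
  ultimately show ?thesis
    by (simp add: filterlim_cong[OF refl refl])
qed

end

lemma fib_lipschitz:
  assumes "z \<bullet> \<phi> = 0" "z' \<bullet> \<phi> = 0"
  shows "norm (fib z t - fib z' t') \<le> fib_const * (norm (z - z') + \<bar>t - t'\<bar>)"
  using fib_estimate[OF N_near fib(1)[OF assms(1)] fib(1)[OF assms(2)], of t t'] assms
  by (simp add: fib inner_simps)

lemma continuous_fib: "continuous_on ({z. z \<bullet> \<phi> = 0} \<times> UNIV) (\<lambda>(z, t). fib z t)"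
proof (rule continuous_onI)
  fix q e assume q: "q \<in> {z. z \<bullet> \<phi> = 0} \<times> (UNIV :: real set)" and e: "e > (0::real)"
  obtain z t where qz: "q = (z, t)" "z \<bullet> \<phi> = 0" using q by auto
  show "\<exists>d>0. \<forall>q'\<in>{z. z \<bullet> \<phi> = 0} \<times> UNIV. dist q' q < d \<longrightarrow>
      dist (case q' of (z, t) \<Rightarrow> fib z t) (case q of (z, t) \<Rightarrow> fib z t) \<le> e"
  proof (intro exI[of _ "e / (2 * fib_const)"] conjI ballI impI)
    show "e / (2 * fib_const) > 0" using e fib_const_pos by simp
    fix q' assume q': "q' \<in> {z. z \<bullet> \<phi> = 0} \<times> (UNIV :: real set)" "dist q' q < e / (2 * fib_const)"
    obtain z' t' where qz': "q' = (z', t')" "z' \<bullet> \<phi> = 0" using q' by auto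
    have "dist z' z \<le> dist q' q" "dist t' t \<le> dist q' q"
      using dist_fst_le[of q' q] dist_snd_le[of q' q] by (simp_all add: qz qz')
    then have "norm (z' - z) + \<bar>t' - t\<bar> \<le> e / fib_const"
      using q'(2) by (simp add: dist_norm field_simps)
    then have "fib_const * (norm (z' - z) + \<bar>t' - t\<bar>) \<le> fib_const * (e / fib_const)"
      using fib_const_pos by (intro mult_left_mono) auto
    also have "\<dots> = e" using fib_const_pos by simp
    finally show "dist (case q' of (z, t) \<Rightarrow> fib z t) (case q of (z, t) \<Rightarrow> fib z t) \<le> e"
      using fib_lipschitz[OF qz'(2) qz(2), of t' t] by (simp add: qz qz' dist_norm)
  qed
qed

lemma continuous_N: "continuous_on A N"
proof -
  have "(\<bar>\<gamma>\<bar> + r)-lipschitz_on A N"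
    using near_gamma_lipschitz[OF N_near] r_nonneg by (intro lipschitz_onI) (auto simp: dist_norm)
  then show ?thesis by (rule lipschitz_on_continuous_on)
qed

lemma continuous_height: "continuous_on ({z. z \<bullet> \<phi> = 0} \<times> UNIV) (\<lambda>(z, t). height z t)"
proof -
  have "continuous_on ({z. z \<bullet> \<phi> = 0} \<times> UNIV)
      (\<lambda>q. lam * snd q - N (case q of (z, t) \<Rightarrow> fib z t) \<bullet> \<phi>)"
    by (intro continuous_intros continuous_fib continuous_on_compose2[OF continuous_N]) auto
  then show ?thesis
    by (rule continuous_on_eq) (auto simp: height_eq)
qed

end

section \<open>Straightening a family of unimodal functions\<close>

lemma continuous_on_uncurry:
  assumes "continuous_on (H \<times> K) (\<lambda>(z, t). f z t)" "continuous_on A g" "continuous_on A h"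
    "g ` A \<subseteq> H" "h ` A \<subseteq> K"
  shows "continuous_on A (\<lambda>x. f (g x) (h x))"
  using continuous_on_compose2[OF assms(1) continuous_on_Pair[OF assms(2,3)]] assms(4,5) by auto

lemma continuous_on_fiberwise_inverse:
  fixes S :: "'z::metric_space \<Rightarrow> real \<Rightarrow> real"
  assumes cont: "\<And>t. continuous_on H (\<lambda>z. S z t)"
    and mono: "\<And>z. z \<in> H \<Longrightarrow> strict_mono (S z)"
    and inv: "\<And>z s. z \<in> H \<Longrightarrow> S z (R z s) = s"
  shows "continuous_on (H \<times> UNIV) (\<lambda>(z, s). R z s)"
  unfolding continuous_on_def
proof
  fix q assume q: "q \<in> H \<times> (UNIV :: real set)"
  obtain z0 s0 where q0: "q = (z0, s0)" "z0 \<in> H" using q by auto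
  define t0 where "t0 = R z0 s0"
  have lim: "((\<lambda>q. S (fst q) t) \<longlongrightarrow> S z0 t) (at q within H \<times> UNIV)" for t
  proof -
    have "continuous_on (H \<times> (UNIV :: real set)) (\<lambda>q. S (fst q) t)"
      by (rule continuous_on_compose2[OF cont]) (auto intro: continuous_intros)
    then show ?thesis using q by (simp add: continuous_on_def q0)
  qed
  have snd: "(snd \<longlongrightarrow> s0) (at q within H \<times> UNIV)"
    using tendsto_snd[OF tendsto_ident_at, of q] by (simp add: q0)
  have S0: "S z0 t0 = s0" using inv q0 by (simp add: t0_def)
  show "((\<lambda>(z, s). R z s) \<longlongrightarrow> (case q of (z, s) \<Rightarrow> R z s)) (at q within H \<times> UNIV)"
  proof (rule tendstoI)
    fix e :: real assume e: "e > 0"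
    have "S z0 (t0 - e) < s0" "s0 < S z0 (t0 + e)"
      using strict_monoD[OF mono[OF q0(2)]] e S0 by (metis diff_less_eq less_add_same_cancel1)+
    then have "\<forall>\<^sub>F q in at q within H \<times> UNIV. S (fst q) (t0 - e) < snd q"
      "\<forall>\<^sub>F q in at q within H \<times> UNIV. snd q < S (fst q) (t0 + e)"
      using order_tendstoD(2)[OF tendsto_diff[OF lim[of "t0 - e"] snd], of 0]
        order_tendstoD(1)[OF tendsto_diff[OF lim[of "t0 + e"] snd], of 0] by simp_all
    moreover have "\<forall>\<^sub>F q in at q within H \<times> UNIV. q \<in> H \<times> UNIV"
      by (simp add: eventually_at_filter)
    ultimately show "\<forall>\<^sub>F p in at q within H \<times> UNIV.
        dist (case p of (z, s) \<Rightarrow> R z s) (case q of (z, s) \<Rightarrow> R z s) < e"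
    proof eventually_elim
      case (elim p)
      obtain z s where p: "p = (z, s)" "z \<in> H" using elim(3) by auto
      have "S z (t0 - e) < S z (R z s)" "S z (R z s) < S z (t0 + e)"
        using elim(1,2) inv[OF p(2)] by (simp_all add: p)
      then have "t0 - e < R z s" "R z s < t0 + e"
        using strict_mono_less[OF mono[OF p(2)]] by blast+
      then show ?case by (simp add: p q0 t0_def[symmetric] dist_real_def)
    qed
  qed
qed

locale ridge =
  fixes H :: "'z::metric_space set" and G :: "'z \<Rightarrow> real \<Rightarrow> real"
  assumes cont: "continuous_on (H \<times> UNIV) (\<lambda>(z, t). G z t)"
    and quasiconcave: "z \<in> H \<Longrightarrow> t1 < t2 \<Longrightarrow> t2 < t3 \<Longrightarrow> min (G z t1) (G z t3) < G z t2"
    and lim_top: "z \<in> H \<Longrightarrow> filterlim (G z) at_bot at_top"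
    and lim_bot: "z \<in> H \<Longrightarrow> filterlim (G z) at_bot at_bot"
begin

lemma cont_fiber: "z \<in> H \<Longrightarrow> continuous_on A (G z)"
  by (rule continuous_on_uncurry[OF cont]) (auto intro: continuous_on_id)

lemma cont_base: "continuous_on H (\<lambda>z. G z t)"
  by (rule continuous_on_uncurry[OF cont]) (auto intro: continuous_on_id)

lemma peak_exists:
  assumes z: "z \<in> H" shows "\<exists>\<tau>. \<forall>t. t \<noteq> \<tau> \<longrightarrow> G z t < G z \<tau>"
proof -
  obtain K1 where K1: "\<And>t. t \<ge> K1 \<Longrightarrow> G z t < G z 0"
    using lim_top[OF z] by (auto simp: filterlim_at_bot_dense eventually_at_top_linorder)
  obtain K2 where K2: "\<And>t. t \<le> K2 \<Longrightarrow> G z t < G z 0"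
    using lim_bot[OF z] by (auto simp: filterlim_at_bot_dense eventually_at_bot_linorder)
  have K: "K2 < 0" "0 < K1" using K1[of 0] K2[of 0] by (auto simp: not_le[symmetric])
  obtain \<tau> where \<tau>: "\<tau> \<in> {K2..K1}" "\<And>t. t \<in> {K2..K1} \<Longrightarrow> G z t \<le> G z \<tau>"
    using continuous_attains_sup[of "{K2..K1}" "G z"] cont_fiber[OF z] K by fastforce
  have max: "G z t \<le> G z \<tau>" for t
    using \<tau>(2)[of t] \<tau>(2)[of 0] K1[of t] K2[of t] K by fastforce
  have "G z t < G z \<tau>" if t: "t \<noteq> \<tau>" for t
  proof (rule ccontr)
    assume "\<not> ?thesis"
    then have eq: "G z t = G z \<tau>" using max[of t] by simp
    have "\<exists>s. G z \<tau> < G z s"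
    proof (cases "t < \<tau>")
      case True
      then show ?thesis using quasiconcave[OF z, of t "(t + \<tau>)/2" \<tau>] eq by auto
    next
      case False
      then show ?thesis using quasiconcave[OF z, of \<tau> "(t + \<tau>)/2" t] eq t by auto
    qed
    then show False using max by (meson not_le)
  qed
  then show ?thesis by blast
qed

definition peak :: "'z \<Rightarrow> real" where
  "peak z = (SOME \<tau>. \<forall>t. t \<noteq> \<tau> \<longrightarrow> G z t < G z \<tau>)"

definition top_value :: "'z \<Rightarrow> real" where
  "top_value z = G z (peak z)"

lemma less_top: "z \<in> H \<Longrightarrow> t \<noteq> peak z \<Longrightarrow> G z t < top_value z"
  using someI_ex[OF peak_exists] unfolding peak_def top_value_def by blast

lemma le_top: "z \<in> H \<Longrightarrow> G z t \<le> top_value z"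
  using less_top[of z t] by (cases "t = peak z") (auto simp: top_value_def)

lemma increasing:
  assumes "z \<in> H" "s < t" "t \<le> peak z" shows "G z s < G z t"
proof (cases "t = peak z")
  case True
  then show ?thesis using less_top[of z s] assms by (simp add: top_value_def)
next
  case False
  then show ?thesis
    using quasiconcave[of z s t "peak z"] less_top[of z t] assms by (simp add: top_value_def min_def split: if_splits)
qed

lemma decreasing:
  assumes "z \<in> H" "s < t" "peak z \<le> s" shows "G z t < G z s"
proof (cases "s = peak z")
  case True
  then show ?thesis using less_top[of z t] assms by (simp add: top_value_def)
next
  case False
  then show ?thesis
    using quasiconcave[of z "peak z" s t] less_top[of z s] assms by (simp add: top_value_def min_def split: if_splits)
qed

lemma continuous_peak: "continuous_on H peak"
  unfolding continuous_on_def
proof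
  fix z0 assume z0: "z0 \<in> H"
  have lim: "((\<lambda>z. G z t) \<longlongrightarrow> G z0 t) (at z0 within H)" for t
    using cont_base[of t] z0 by (simp add: continuous_on_def)
  show "(peak \<longlongrightarrow> peak z0) (at z0 within H)"
  proof (rule tendstoI)
    fix e :: real assume e: "e > 0"
    let ?t = "peak z0"
    have "G z0 (?t + e) < G z0 ?t" "G z0 (?t - e) < G z0 ?t"
      using less_top[OF z0] e by (simp_all add: top_value_def)
    then have "\<forall>\<^sub>F z in at z0 within H. G z (?t + e) < G z ?t"
      "\<forall>\<^sub>F z in at z0 within H. G z (?t - e) < G z ?t"
      using order_tendstoD(2)[OF tendsto_diff[OF lim[of "?t + e"] lim[of ?t]], of 0]
        order_tendstoD(2)[OF tendsto_diff[OF lim[of "?t - e"] lim[of ?t]], of 0] by simp_all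
    moreover have "\<forall>\<^sub>F z in at z0 within H. z \<in> H"
      by (simp add: eventually_at_filter)
    ultimately show "\<forall>\<^sub>F z in at z0 within H. dist (peak z) (peak z0) < e"
    proof eventually_elim
      case (elim z)
      have "peak z < ?t + e" using increasing[of z ?t "?t + e"] elim e by force
      moreover have "?t - e < peak z" using decreasing[of z "?t - e" ?t] elim e by force
      ultimately show ?case by (simp add: dist_real_def)
    qed
  qed
qed

lemma continuous_top: "continuous_on H top_value"
  unfolding top_value_def
  by (rule continuous_on_uncurry[OF cont]) (auto intro: continuous_on_id continuous_peak)

definition fold_coord :: "'z \<Rightarrow> real \<Rightarrow> real" where
  "fold_coord z t = (if t - peak z \<le> 0 then - sqrt (top_value z - G z t) else sqrt (top_value z - G z t))"

lemma height_fold_coord: "z \<in> H \<Longrightarrow> G z t = top_value z - (fold_coord z t)\<^sup>2"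
  using le_top[of z t] by (simp add: fold_coord_def)

lemma strict_mono_fold_coord: "z \<in> H \<Longrightarrow> strict_mono (fold_coord z)"
proof (rule strict_monoI)
  fix s t assume z: "z \<in> H" and st: "s < (t::real)"
  consider "t \<le> peak z" | "peak z < s \<or> s = peak z" | "s < peak z" "peak z < t" by linarith
  then show "fold_coord z s < fold_coord z t"
  proof cases
    case 1
    then show ?thesis using increasing[OF z st] st by (simp add: fold_coord_def)
  next
    case 2
    then show ?thesis
      using decreasing[OF z st] less_top[OF z, of t] st by (auto simp: fold_coord_def top_value_def)
  next
    case 3
    then have "- sqrt (top_value z - G z s) < 0" "0 < sqrt (top_value z - G z t)"
      using less_top[OF z, of s] less_top[OF z, of t] by auto
    then show ?thesis using 3 unfolding fold_coord_def by (smt (verit))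
  qed
qed

lemma continuous_fold_coord: "continuous_on (H \<times> UNIV) (\<lambda>(z, t). fold_coord z t)"
proof -
  have G: "continuous_on A (\<lambda>q. G (fst q) (snd q))" if "A \<subseteq> H \<times> UNIV" for A
    using continuous_on_subset[OF cont that] by (simp add: case_prod_unfold)
  have T: "continuous_on A (\<lambda>q. top_value (fst q))" if "A \<subseteq> H \<times> (UNIV :: real set)" for A
    by (rule continuous_on_compose2[OF continuous_top]) (use that in \<open>auto intro: continuous_intros\<close>)
  have P: "continuous_on (H \<times> (UNIV :: real set)) (\<lambda>q. peak (fst q))"
    by (rule continuous_on_compose2[OF continuous_peak]) (auto intro: continuous_intros)
  show ?thesis
    unfolding case_prod_unfold fold_coord_def
  proof (rule continuous_on_cases_le)
    show "continuous_on (H \<times> UNIV) (\<lambda>q. snd q - peak (fst q))"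
      by (intro continuous_intros P)
  next
    fix q :: "'z \<times> real" assume "q \<in> H \<times> UNIV" "snd q - peak (fst q) = 0"
    then show "- sqrt (top_value (fst q) - G (fst q) (snd q)) = sqrt (top_value (fst q) - G (fst q) (snd q))"
      by (simp add: top_value_def)
  qed (auto intro!: continuous_intros G T)
qed

lemma surj_fold_coord:
  assumes z: "z \<in> H" shows "\<exists>t. fold_coord z t = s"
proof -
  have cont: "continuous_on UNIV (fold_coord z)"
    by (rule continuous_on_uncurry[OF continuous_fold_coord]) (use z in \<open>auto intro: continuous_on_id\<close>)
  have "\<forall>\<^sub>F t in at_top. G z t < top_value z - s\<^sup>2" "\<forall>\<^sub>F t in at_bot. G z t < top_value z - s\<^sup>2"
    using lim_top[OF z] lim_bot[OF z] by (auto simp: filterlim_at_bot_dense)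
  moreover have "\<forall>\<^sub>F t in at_top. t > peak z" "\<forall>\<^sub>F t in at_bot. t < peak z"
    by (auto intro: eventually_gt_at_top eventually_at_bot_dense[THEN iffD2])
  ultimately have "\<forall>\<^sub>F t in at_top. G z t < top_value z - s\<^sup>2 \<and> t > peak z"
    "\<forall>\<^sub>F t in at_bot. G z t < top_value z - s\<^sup>2 \<and> t < peak z"
    by (auto simp: eventually_conj_iff)
  then obtain t1 t2 where t2: "G z t2 < top_value z - s\<^sup>2" "t2 > peak z"
    and t1: "G z t1 < top_value z - s\<^sup>2" "t1 < peak z"
    by (metis (mono_tags, lifting) eventually_happens trivial_limit_at_top_linorder trivial_limit_at_bot_linorder)
  have "\<bar>s\<bar> < sqrt (top_value z - G z t1)" "\<bar>s\<bar> < sqrt (top_value z - G z t2)"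
    using t1 t2 by (intro real_less_rsqrt; simp)+
  then have "fold_coord z t1 \<le> s" "s \<le> fold_coord z t2"
    using t1(2) t2(2) by (auto simp: fold_coord_def)
  moreover have "t1 \<le> t2" using t1 t2 by simp
  ultimately show ?thesis
    using IVT'[of "fold_coord z" t1 s t2] continuous_on_subset[OF cont] by auto
qed

definition unfold_coord :: "'z \<Rightarrow> real \<Rightarrow> real" where
  "unfold_coord z = inv (fold_coord z)"

lemma fold_unfold: "z \<in> H \<Longrightarrow> fold_coord z (unfold_coord z s) = s"
  unfolding unfold_coord_def by (rule surj_f_inv_f) (metis surj_fold_coord surjI surj_def)

lemma unfold_fold: "z \<in> H \<Longrightarrow> unfold_coord z (fold_coord z t) = t"
  unfolding unfold_coord_def by (rule inv_f_f) (metis strict_mono_fold_coord strict_mono_imp_inj_on)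

lemma continuous_unfold_coord: "continuous_on (H \<times> UNIV) (\<lambda>(z, s). unfold_coord z s)"
proof (rule continuous_on_fiberwise_inverse[where S = fold_coord])
  show "continuous_on H (\<lambda>z. fold_coord z t)" for t
    by (rule continuous_on_uncurry[OF continuous_fold_coord]) (auto intro: continuous_on_id)
qed (simp_all add: strict_mono_fold_coord fold_unfold)

end

section \<open>Convex Nemytskii operators on square-integrable functions\<close>

lemma norm_L2_le:
  fixes u w :: "'n::finite L2"
  assumes C: "C \<ge> 0" and bound: "AE x in lborel. \<bar>rep u x\<bar> \<le> C * \<bar>rep w x\<bar>"
  shows "norm u \<le> C * norm w"
proof -
  have "(norm u)\<^sup>2 \<le> (\<integral>x. C\<^sup>2 * (rep w x)\<^sup>2 \<partial>lborel)"
    unfolding norm_L2_sq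
  proof (rule integral_mono_AE)
    show "integrable lborel (\<lambda>x. (rep u x)\<^sup>2)" "integrable lborel (\<lambda>x. C\<^sup>2 * (rep w x)\<^sup>2)"
      using sq_int_rep[of u] sq_int_rep[of w] by (auto simp: sq_int_def)
    show "AE x in lborel. (rep u x)\<^sup>2 \<le> C\<^sup>2 * (rep w x)\<^sup>2"
      using bound
    proof eventually_elim
      case (elim x)
      show ?case using power_mono[OF elim, of 2] by (simp add: power_mult_distrib)
    qed
  qed
  also have "\<dots> = (C * norm w)\<^sup>2" by (simp add: norm_L2_sq power_mult_distrib)
  finally show ?thesis by (rule power2_le_imp_le) (use C in simp)
qed

lemma L2_dominated_convergence:
  fixes X :: "nat \<Rightarrow> 'n::finite L2"
  assumes bound: "\<And>n. AE x in lborel. \<bar>rep (X n) x\<bar> \<le> C * \<bar>rep h x\<bar>"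
    and lim: "AE x in lborel. (\<lambda>n. rep (X n) x) \<longlonglongrightarrow> rep u x"
  shows "X \<longlonglongrightarrow> u"
proof -
  define w where "w x = C * \<bar>rep h x\<bar> + \<bar>rep u x\<bar>" for x
  have [measurable]: "w \<in> borel_measurable lborel" unfolding w_def by measurable
  have "sq_int (\<lambda>x. \<bar>rep v x\<bar>)" for v :: "'n L2"
    by (rule sq_int_bound[OF sq_int_rep[of v], where C = 1]) auto
  then have "sq_int w" unfolding w_def by (intro sq_int_add sq_int_cmult)
  then have w: "integrable lborel (\<lambda>x. (w x)\<^sup>2)" by (simp add: sq_int_def)
  have "(\<lambda>n. \<integral>x. (rep (X n) x - rep u x)\<^sup>2 \<partial>lborel) \<longlonglongrightarrow> (\<integral>x. 0 \<partial>(lborel :: (real^'n) measure))"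
  proof (rule integral_dominated_convergence[OF _ _ w])
    show "AE x in lborel. (\<lambda>n. (rep (X n) x - rep u x)\<^sup>2) \<longlonglongrightarrow> 0"
      using lim
    proof eventually_elim
      case (elim x)
      have "(\<lambda>n. (rep (X n) x - rep u x)\<^sup>2) \<longlonglongrightarrow> (rep u x - rep u x)\<^sup>2"
        by (intro tendsto_intros elim)
      then show ?case by simp
    qed
    show "AE x in lborel. norm ((rep (X n) x - rep u x)\<^sup>2) \<le> (w x)\<^sup>2" for n
      using bound[of n]
    proof eventually_elim
      case (elim x)
      have "\<bar>rep (X n) x - rep u x\<bar> \<le> w x" using elim by (simp add: w_def)
      from power_mono[OF this, of 2] show ?case by simp
    qed
  qed measurable
  moreover have "(\<integral>x. (rep (X n) x - rep u x)\<^sup>2 \<partial>lborel) = (norm (X n - u))\<^sup>2" for n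
    unfolding norm_L2_sq
    by (rule integral_cong_AE) (use rep_diff[of "X n" u] in \<open>auto elim: AE_mp\<close>)
  ultimately have "(\<lambda>n. (norm (X n - u))\<^sup>2) \<longlonglongrightarrow> 0" by simp
  then have "(\<lambda>n. norm (X n - u)) \<longlonglongrightarrow> 0"
    using tendsto_real_sqrt[of "\<lambda>n. (norm (X n - u))\<^sup>2" 0] by simp
  then show ?thesis
    using tendsto_norm_zero_iff LIM_zero_cancel by blast
qed

lemma quotient_tendsto_sup_derivative:
  fixes g :: "real \<Rightarrow> real"
  assumes D: "\<And>x. DERIV g x :> g' x" and mono: "mono g'" and g0: "g 0 = 0"
    and less: "\<And>x. g' x < B" and sup: "\<And>c. c < B \<Longrightarrow> \<exists>x. c < g' x"
  shows "((\<lambda>y. g y / y) \<longlongrightarrow> B) at_top"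
proof (rule order_tendstoI)
  have upper: "g y / y < B" if y: "y > 0" for y
  proof -
    obtain \<xi> where "0 < \<xi>" "g y - g 0 = (y - 0) * g' \<xi>"
      using MVT2[OF y] D by blast
    then have "g y = y * g' \<xi>" using g0 by simp
    then show ?thesis using less[of \<xi>] y by (simp add: field_simps)
  qed
  fix c assume c: "B < c"
  show "\<forall>\<^sub>F y in at_top. g y / y < c"
    using eventually_gt_at_top[of 0] by eventually_elim (use upper c in \<open>auto intro: less_trans\<close>)
next
  fix c assume c: "c < B"
  then obtain c' where c': "c < c'" "c' < B" using dense by blast
  then obtain x0 where x0: "c' < g' x0" using sup by blast
  define y0 where "y0 = max x0 1"
  have y0: "y0 > 0" "c' < g' y" if "y \<ge> y0" for y
    using x0 monoD[OF mono, of x0 y] that by (auto simp: y0_def)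
  have low: "g y \<ge> g y0 + c' * (y - y0)" if y: "y > y0" for y
  proof -
    obtain \<xi> where "y0 < \<xi>" "g y - g y0 = (y - y0) * g' \<xi>"
      using MVT2[OF y] D by blast
    moreover have "(y - y0) * c' \<le> (y - y0) * g' \<xi>"
      using y0(2)[of \<xi>] \<open>y0 < \<xi>\<close> y by (intro mult_left_mono) auto
    ultimately show ?thesis by (simp add: mult.commute)
  qed
  show "\<forall>\<^sub>F y in at_top. c < g y / y"
    using eventually_gt_at_top[of y0] eventually_gt_at_top[of "(c' * y0 - g y0) / (c' - c)"]
  proof eventually_elim
    case (elim y)
    have "c' * y0 - g y0 < y * (c' - c)" using elim(2) c' by (simp add: field_simps)
    then have "c * y < g y" using low[OF elim(1)] by (simp add: algebra_simps)
    moreover have "y > 0" using elim(1) y0(1)[of y0] by simp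
    ultimately show ?case by (simp add: field_simps)
  qed
qed

locale convex_nonlinearity =
  fixes f f' :: "real \<Rightarrow> real" and a b :: real
  assumes DERIV_f: "DERIV f x :> f' x" and strict_mono: "strict_mono f'"
    and range_f': "range f' = {a<..<b}" and f_0: "f 0 = 0"
begin

lemma f'_bounds: "a < f' x" "f' x < b"
  using range_f' by (metis greaterThanLessThan_iff rangeI)+

lemma mono_f': "mono f'"
  using strict_mono by (rule strict_mono_mono)

lemma mvt: obtains \<xi> where "f y - f x = f' \<xi> * (y - x)" "x < y \<Longrightarrow> x < \<xi>" "y < x \<Longrightarrow> \<xi> < x"
proof (cases x y rule: linorder_cases)
  case less
  then show ?thesis using MVT2[OF less, of f f'] DERIV_f that by (metis mult.commute less_asym)
next
  case greater
  obtain \<xi> where \<xi>: "\<xi> < x" "f x - f y = (x - y) * f' \<xi>"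
    using MVT2[OF greater, of f f'] DERIV_f by blast
  then show ?thesis using that[of \<xi>] greater by (simp add: algebra_simps)
qed (use that in auto)

lemma f_near:
  assumes "\<And>x. \<bar>f' x - \<gamma>\<bar> \<le> r" shows "\<bar>f y - f x - \<gamma> * (y - x)\<bar> \<le> r * \<bar>y - x\<bar>"
proof -
  obtain \<xi> where "f y - f x = f' \<xi> * (y - x)" using mvt by blast
  then have "\<bar>f y - f x - \<gamma> * (y - x)\<bar> = \<bar>f' \<xi> - \<gamma>\<bar> * \<bar>y - x\<bar>"
    by (simp add: abs_mult[symmetric] algebra_simps)
  also have "\<dots> \<le> r * \<bar>y - x\<bar>" using assms by (intro mult_right_mono) auto
  finally show ?thesis .
qed

definition lip :: real where "lip = \<bar>a\<bar> + \<bar>b\<bar>"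

lemma lip_nonneg: "0 \<le> lip" by (simp add: lip_def)

lemma abs_f'_le: "\<bar>f' x\<bar> \<le> lip"
  using f'_bounds[of x] by (simp add: lip_def)

lemma f_lip: "\<bar>f y - f x\<bar> \<le> lip * \<bar>y - x\<bar>"
  using f_near[of 0 lip y x] abs_f'_le by simp

lemma f_measurable [measurable]: "f \<in> borel_measurable borel"
  by (intro borel_measurable_continuous_onI DERIV_continuous_on)
    (use DERIV_f in \<open>auto intro: DERIV_subset\<close>)

lemma f'_measurable [measurable]: "f' \<in> borel_measurable borel"
  by (rule borel_measurable_mono[OF mono_f'])

lemma strictly_convex: "y \<noteq> x \<Longrightarrow> 0 < f y - f x - f' x * (y - x)"
proof -
  assume ne: "y \<noteq> x"
  obtain \<xi> where \<xi>: "f y - f x = f' \<xi> * (y - x)" "x < y \<Longrightarrow> x < \<xi>" "y < x \<Longrightarrow> \<xi> < x"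
    using mvt by blast
  have "0 < (f' \<xi> - f' x) * (y - x)"
  proof (cases "x < y")
    case True
    then show ?thesis using \<xi>(2) strict_monoD[OF strict_mono, of x \<xi>] by simp
  next
    case False
    then show ?thesis using ne \<xi>(3) strict_monoD[OF strict_mono, of \<xi> x]
      by (intro mult_neg_neg) auto
  qed
  then show ?thesis using \<xi>(1) by (simp add: algebra_simps)
qed

lemma f_div_at_top: "((\<lambda>y. f y / y) \<longlongrightarrow> b) at_top"
proof (rule quotient_tendsto_sup_derivative[OF DERIV_f mono_f' f_0])
  show "f' x < b" for x by (rule f'_bounds)
  show "\<exists>x. c < f' x" if c: "c < b" for c
  proof -
    have "a < b" using f'_bounds[of 0] by simp
    then obtain d where d: "max a c < d" "d < b" using dense[of "max a c" b] c by auto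
    then have "d \<in> range f'" by (simp add: range_f')
    then show ?thesis using d by auto
  qed
qed

lemma f_div_at_bot: "((\<lambda>y. f y / y) \<longlongrightarrow> a) at_bot"
proof -
  have "((\<lambda>y. f (- y) / y) \<longlongrightarrow> - a) at_top"
  proof (rule quotient_tendsto_sup_derivative[where g' = "\<lambda>x. - f' (- x)"])
    show "DERIV (\<lambda>y. f (- y)) x :> - f' (- x)" for x
    proof -
      have "DERIV (\<lambda>y. f (- y)) x :> f' (- x) * (- 1)"
        by (rule DERIV_chain2[OF DERIV_f]) (auto intro!: derivative_eq_intros)
      then show ?thesis by simp
    qed
    show "mono (\<lambda>x. - f' (- x))" using mono_f' by (auto simp: mono_def)
    show "- f' (- x) < - a" for x using f'_bounds by simp
    show "\<exists>x. c < - f' (- x)" if c: "c < - a" for c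
    proof -
      have "a < b" using f'_bounds[of 0] by simp
      then obtain d where d: "a < d" "d < min b (- c)" using dense[of a "min b (- c)"] c by auto
      then have "d \<in> range f'" by (simp add: range_f')
      then obtain x where "d = f' x" by blast
      then show ?thesis using d by (intro exI[of _ "- x"]) auto
    qed
  qed (simp add: f_0)
  from tendsto_minus[OF this] show ?thesis
    by (simp add: filterlim_at_bot_mirror)
qed

lemma sq_int_f: "sq_int (\<lambda>x. f (rep u x))"
  by (rule sq_int_bound[OF sq_int_rep[of u], where C = lip])
    (use f_lip[of _ 0] f_0 in auto)

lemma rep_nemytskii: "AE x in lborel. rep (nemytskii f u) x = f (rep u x)"
  unfolding nemytskii_def by (rule rep_mkL2[OF sq_int_f])

definition mult_op :: "'n::finite L2 \<Rightarrow> 'n L2 \<Rightarrow> 'n L2" where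
  "mult_op u h = mkL2 (\<lambda>x. f' (rep u x) * rep h x)"

lemma rep_mult_op: "AE x in lborel. rep (mult_op u h) x = f' (rep u x) * rep h x"
  unfolding mult_op_def
  by (rule rep_mkL2, rule sq_int_bound[OF sq_int_rep[of h], where C = lip])
    (auto simp: abs_mult intro!: mult_right_mono abs_f'_le)

lemma nemytskii_near:
  assumes "\<And>x. \<bar>f' x - \<gamma>\<bar> \<le> r" and r: "r \<ge> 0"
  shows "norm (nemytskii f u - nemytskii f w - \<gamma> *\<^sub>R (u - w)) \<le> r * norm (u - w)"
proof (rule norm_L2_le[OF r])
  show "AE x in lborel. \<bar>rep (nemytskii f u - nemytskii f w - \<gamma> *\<^sub>R (u - w)) x\<bar> \<le> r * \<bar>rep (u - w) x\<bar>"
    using rep_diff[of "nemytskii f u - nemytskii f w" "\<gamma> *\<^sub>R (u - w)"] rep_diff[of "nemytskii f u" "nemytskii f w"]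
      rep_scaleR[of \<gamma> "u - w"] rep_diff[of u w] rep_nemytskii[of u] rep_nemytskii[of w]
    by eventually_elim (use f_near[OF assms(1)] in auto)
qed

lemma mult_op_linear: "linear (mult_op u)"
proof (rule linearI)
  fix x y :: "'a L2" and c :: real
  show "mult_op u (x + y) = mult_op u x + mult_op u y"
    using rep_mult_op[of u "x + y"] rep_add[of x y] rep_add[of "mult_op u x" "mult_op u y"]
      rep_mult_op[of u x] rep_mult_op[of u y]
    by (intro L2_eqI) (auto simp: algebra_simps)
  show "mult_op u (c *\<^sub>R x) = c *\<^sub>R mult_op u x"
    using rep_mult_op[of u "c *\<^sub>R x"] rep_scaleR[of c x] rep_scaleR[of c "mult_op u x"]
      rep_mult_op[of u x]
    by (intro L2_eqI) auto
qed

lemma mult_op_near: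
  assumes "\<And>x. \<bar>f' x - \<gamma>\<bar> \<le> r" and r: "r \<ge> 0"
  shows "norm (mult_op v u - mult_op v w - \<gamma> *\<^sub>R (u - w)) \<le> r * norm (u - w)"
proof (rule norm_L2_le[OF r])
  show "AE x in lborel. \<bar>rep (mult_op v u - mult_op v w - \<gamma> *\<^sub>R (u - w)) x\<bar> \<le> r * \<bar>rep (u - w) x\<bar>"
    using rep_diff[of "mult_op v u - mult_op v w" "\<gamma> *\<^sub>R (u - w)"] rep_diff[of "mult_op v u" "mult_op v w"]
      rep_scaleR[of \<gamma> "u - w"] rep_diff[of u w] rep_mult_op[of v u] rep_mult_op[of v w]
  proof eventually_elim
    case (elim x)
    have "rep (mult_op v u - mult_op v w - \<gamma> *\<^sub>R (u - w)) x = (f' (rep v x) - \<gamma>) * rep (u - w) x"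
      unfolding elim by (simp add: algebra_simps)
    then show ?case by (simp add: abs_mult mult_right_mono assms(1))
  qed
qed

lemma mult_op_sym: "inner (mult_op u x) y = inner x (mult_op u y)"
proof -
  have "inner (mult_op u x) y = (\<integral>t. f' (rep u t) * rep x t * rep y t \<partial>lborel)"
    unfolding inner_L2_def by (rule L2_inner_cong) (use rep_mult_op[of u x] in auto)
  also have "\<dots> = inner x (mult_op u y)"
    unfolding inner_L2_def
    by (rule L2_inner_cong[symmetric]) (use rep_mult_op[of u y] in \<open>auto simp: algebra_simps\<close>)
  finally show ?thesis .
qed

lemma nemytskii_gateaux:
  "((\<lambda>s. (1/s) *\<^sub>R (nemytskii f (u + s *\<^sub>R h) - nemytskii f u)) \<longlongrightarrow> mult_op u h) (at 0)"
  unfolding tendsto_at_iff_sequentially comp_def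
proof (intro allI impI)
  fix s :: "nat \<Rightarrow> real" assume s: "\<forall>i. s i \<in> UNIV - {0}" "s \<longlonglongrightarrow> 0"
  define q where "q n x = (f (rep u x + s n * rep h x) - f (rep u x)) / s n" for n x
  have rep: "AE x in lborel. rep ((1 / s n) *\<^sub>R (nemytskii f (u + s n *\<^sub>R h) - nemytskii f u)) x = q n x" for n
    using rep_scaleR[of "1 / s n" "nemytskii f (u + s n *\<^sub>R h) - nemytskii f u"]
      rep_diff[of "nemytskii f (u + s n *\<^sub>R h)" "nemytskii f u"] rep_nemytskii[of u]
      rep_nemytskii[of "u + s n *\<^sub>R h"] rep_add[of u "s n *\<^sub>R h"] rep_scaleR[of "s n" h]
    by eventually_elim (simp add: q_def)
  show "(\<lambda>n. (1 / s n) *\<^sub>R (nemytskii f (u + s n *\<^sub>R h) - nemytskii f u)) \<longlonglongrightarrow> mult_op u h"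
  proof (rule L2_dominated_convergence[where C = lip and h = h])
    show "AE x in lborel. \<bar>rep ((1 / s n) *\<^sub>R (nemytskii f (u + s n *\<^sub>R h) - nemytskii f u)) x\<bar> \<le> lip * \<bar>rep h x\<bar>" for n
      using rep[of n]
    proof eventually_elim
      case (elim x)
      have "s n \<noteq> 0" using s by auto
      then show ?case
        unfolding elim q_def using f_lip[of "rep u x + s n * rep h x" "rep u x"]
        by (simp add: abs_mult field_simps)
    qed
    have "AE x in lborel. \<forall>n. rep ((1 / s n) *\<^sub>R (nemytskii f (u + s n *\<^sub>R h) - nemytskii f u)) x = q n x"
      unfolding AE_all_countable using rep by blast
    then show "AE x in lborel. (\<lambda>n. rep ((1 / s n) *\<^sub>R (nemytskii f (u + s n *\<^sub>R h) - nemytskii f u)) x)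
        \<longlonglongrightarrow> rep (mult_op u h) x"
      using rep_mult_op[of u h]
    proof eventually_elim
      case (elim x)
      have "DERIV (\<lambda>s. f (rep u x + s * rep h x)) 0 :> f' (rep u x + 0 * rep h x) * rep h x"
        by (rule DERIV_chain2[OF DERIV_f]) (auto intro!: derivative_eq_intros)
      then have "((\<lambda>s. (f (rep u x + s * rep h x) - f (rep u x)) / s) \<longlongrightarrow> f' (rep u x) * rep h x) (at 0)"
        by (simp add: DERIV_def)
      then have "(\<lambda>n. q n x) \<longlonglongrightarrow> f' (rep u x) * rep h x"
        using s by (auto simp: tendsto_at_iff_sequentially comp_def q_def)
      then show ?case using elim by simp
    qed
  qed
qed

lemma nemytskii_ray_lim:
  assumes pos: "AE x in lborel. 0 < rep \<phi> x"
    and t: "\<And>y. y > 0 \<Longrightarrow> (\<lambda>n. f (t n * y) / (t n * y)) \<longlonglongrightarrow> c"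
  shows "(\<lambda>n. (1 / t n) *\<^sub>R nemytskii f (t n *\<^sub>R \<phi>)) \<longlonglongrightarrow> c *\<^sub>R \<phi>"
proof -
  define q where "q n x = (1 / t n) * f (t n * rep \<phi> x)" for n x
  have rep: "AE x in lborel. rep ((1 / t n) *\<^sub>R nemytskii f (t n *\<^sub>R \<phi>)) x = q n x" for n
    using rep_scaleR[of "1 / t n" "nemytskii f (t n *\<^sub>R \<phi>)"] rep_nemytskii[of "t n *\<^sub>R \<phi>"]
      rep_scaleR[of "t n" \<phi>]
    by eventually_elim (simp add: q_def)
  show ?thesis
  proof (rule L2_dominated_convergence[where C = lip and h = \<phi>])
    show "AE x in lborel. \<bar>rep ((1 / t n) *\<^sub>R nemytskii f (t n *\<^sub>R \<phi>)) x\<bar> \<le> lip * \<bar>rep \<phi> x\<bar>" for n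
      using rep[of n]
    proof eventually_elim
      case (elim x)
      show ?case
        unfolding elim q_def using f_lip[of "t n * rep \<phi> x" 0] lip_nonneg
        by (cases "t n = 0") (simp_all add: f_0 abs_mult field_simps)
    qed
    have "AE x in lborel. \<forall>n. rep ((1 / t n) *\<^sub>R nemytskii f (t n *\<^sub>R \<phi>)) x = q n x"
      unfolding AE_all_countable using rep by blast
    then show "AE x in lborel. (\<lambda>n. rep ((1 / t n) *\<^sub>R nemytskii f (t n *\<^sub>R \<phi>)) x) \<longlonglongrightarrow> rep (c *\<^sub>R \<phi>) x"
      using rep_scaleR[of c \<phi>] pos
    proof eventually_elim
      case (elim x)
      have "(\<lambda>n. f (t n * rep \<phi> x) / (t n * rep \<phi> x) * rep \<phi> x) \<longlonglongrightarrow> c * rep \<phi> x"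
        by (intro tendsto_mult_right t elim)
      moreover have "f (t n * rep \<phi> x) / (t n * rep \<phi> x) * rep \<phi> x = q n x" for n
        using elim(3) by (simp add: q_def)
      ultimately show ?case using elim by simp
    qed
  qed
qed

lemma nemytskii_ray_at_top:
  assumes "AE x in lborel. 0 < rep \<phi> x"
  shows "((\<lambda>t. (1/t) *\<^sub>R nemytskii f (t *\<^sub>R \<phi>)) \<longlongrightarrow> b *\<^sub>R \<phi>) at_top"
proof (rule tendsto_at_topI_sequentially, rule nemytskii_ray_lim[OF assms])
  fix t :: "nat \<Rightarrow> real" and y :: real assume "filterlim t at_top sequentially" "y > 0"
  then have "filterlim (\<lambda>n. t n * y) at_top sequentially"
    by (intro filterlim_at_top_mult_tendsto_pos[OF tendsto_const])
  from filterlim_compose[OF f_div_at_top this] show "(\<lambda>n. f (t n * y) / (t n * y)) \<longlonglongrightarrow> b" .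
qed

lemma nemytskii_ray_at_bot:
  assumes "AE x in lborel. 0 < rep \<phi> x"
  shows "((\<lambda>t. (1/t) *\<^sub>R nemytskii f (t *\<^sub>R \<phi>)) \<longlongrightarrow> a *\<^sub>R \<phi>) at_bot"
proof (rule tendsto_at_botI_sequentially, rule nemytskii_ray_lim[OF assms])
  fix t :: "nat \<Rightarrow> real" and y :: real assume "filterlim t at_bot sequentially" "y > 0"
  then have "filterlim (\<lambda>n. y * t n) at_bot sequentially"
    by (intro filterlim_tendsto_pos_mult_at_bot[OF tendsto_const])
  then have "filterlim (\<lambda>n. t n * y) at_bot sequentially" by (simp add: mult.commute)
  from filterlim_compose[OF f_div_at_bot this] show "(\<lambda>n. f (t n * y) / (t n * y)) \<longlonglongrightarrow> a" .
qed

lemma nemytskii_strictly_convex: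
  assumes pos: "AE x in lborel. 0 < rep \<psi> x" and ne: "w \<noteq> u"
  shows "0 < inner (nemytskii f w - nemytskii f u - mult_op u (w - u)) \<psi>"
proof -
  define e where "e = nemytskii f w - nemytskii f u - mult_op u (w - u)"
  have e: "AE x in lborel. rep e x = f (rep w x) - f (rep u x) - f' (rep u x) * (rep w x - rep u x)"
    unfolding e_def
    using rep_diff[of "nemytskii f w - nemytskii f u" "mult_op u (w - u)"] rep_diff[of "nemytskii f w" "nemytskii f u"]
      rep_mult_op[of u "w - u"] rep_diff[of w u] rep_nemytskii[of u] rep_nemytskii[of w]
    by eventually_elim simp
  have int: "integrable lborel (\<lambda>x. rep e x * rep \<psi> x)"
    by (intro sq_int_mult sq_int_rep)
  have nonneg: "AE x in lborel. 0 \<le> rep e x * rep \<psi> x"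
    using e pos
  proof eventually_elim
    case (elim x)
    have "0 \<le> rep e x"
      using strictly_convex[of "rep w x" "rep u x"] elim(1) by (cases "rep w x = rep u x") auto
    then show ?case using elim(2) by simp
  qed
  have "inner e \<psi> \<noteq> 0"
  proof
    assume "inner e \<psi> = 0"
    then have "AE x in lborel. rep e x * rep \<psi> x = 0"
      using integral_nonneg_eq_0_iff_AE[OF int nonneg] by (simp add: inner_L2_def L2_inner_def)
    then have "AE x in lborel. rep w x = rep u x"
      using e pos
    proof eventually_elim
      case (elim x)
      then have "f (rep w x) - f (rep u x) - f' (rep u x) * (rep w x - rep u x) = 0" by simp
      then show ?case using strictly_convex[of "rep w x" "rep u x"] by (metis less_irrefl)
    qed
    then show False using ne L2_eqI by blast
  qed
  moreover have "0 \<le> inner e \<psi>"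
    unfolding inner_L2_def L2_inner_def by (rule integral_nonneg_AE[OF nonneg])
  ultimately show ?thesis by (simp add: e_def)
qed

end

section \<open>The fold\<close>

sublocale fold_map \<subseteq> ridge "{z. z \<bullet> \<phi> = 0}" height
  by unfold_locales (use continuous_height height_quasiconcave height_at_top height_at_bot in auto)

context fold_map
begin

definition zeta :: "'a \<Rightarrow> 'a \<times> real" where
  "zeta u = (let z = proj (T u - N u) in (z, fold_coord z (u \<bullet> \<phi>)))"

definition zeta_inv :: "'a \<times> real \<Rightarrow> 'a" where
  "zeta_inv q = fib (fst q) (unfold_coord (fst q) (snd q))"

definition xi :: "'a \<Rightarrow> 'a \<times> real" where
  "xi y = (proj y, y \<bullet> \<phi> - top_value (proj y))"

definition xi_inv :: "'a \<times> real \<Rightarrow> 'a" where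
  "xi_inv q = fst q + (snd q + top_value (fst q)) *\<^sub>R \<phi>"

lemma zeta_range: "zeta u \<in> {z. z \<bullet> \<phi> = 0} \<times> UNIV"
  by (simp add: zeta_def Let_def)

lemma zeta_inv_zeta: "u \<in> X \<Longrightarrow> zeta_inv (zeta u) = u"
  by (simp add: zeta_def zeta_inv_def Let_def unfold_fold fib_eqI)

lemma zeta_inv_in: "q \<in> {z. z \<bullet> \<phi> = 0} \<times> UNIV \<Longrightarrow> zeta_inv q \<in> X"
  by (auto simp: zeta_inv_def fib)

lemma zeta_zeta_inv: "q \<in> {z. z \<bullet> \<phi> = 0} \<times> UNIV \<Longrightarrow> zeta (zeta_inv q) = q"
  by (auto simp: zeta_def zeta_inv_def Let_def fib fold_unfold)

lemma xi_range: "xi y \<in> {z. z \<bullet> \<phi> = 0} \<times> UNIV"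
  by (simp add: xi_def)

lemma xi_inv_xi: "xi_inv (xi y) = y"
  by (simp add: xi_inv_def xi_def proj_def)

lemma xi_xi_inv: "q \<in> {z. z \<bullet> \<phi> = 0} \<times> UNIV \<Longrightarrow> xi (xi_inv q) = q"
  by (auto simp: xi_inv_def xi_def proj_add proj_scaleR proj_phi proj_idem inner_simps inner_phi)

lemma xi_F_zeta_inv:
  assumes z: "z \<bullet> \<phi> = 0"
  shows "xi (T (zeta_inv (z, s)) - N (zeta_inv (z, s))) = (z, - (s\<^sup>2))"
proof -
  define t where "t = unfold_coord z s"
  have "T (zeta_inv (z, s)) - N (zeta_inv (z, s)) = z + height z t *\<^sub>R \<phi>"
    using height_decomp[OF z, of t] by (simp add: zeta_inv_def t_def)
  moreover have "height z t = top_value z - s\<^sup>2"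
    using height_fold_coord[of z t] z by (simp add: t_def fold_unfold)
  ultimately show ?thesis
    using z by (simp add: xi_def proj_add proj_scaleR proj_phi proj_idem inner_simps inner_phi)
qed

lemma continuous_proj [continuous_intros]: "continuous_on A g \<Longrightarrow> continuous_on A (\<lambda>x. proj (g x))"
  unfolding proj_def by (intro continuous_intros)

lemma continuous_zeta:
  "continuous_on UNIV (\<lambda>p. (proj (snd p - N (fst p)), fold_coord (proj (snd p - N (fst p))) (fst p \<bullet> \<phi>)))"
proof -
  have *: "continuous_on UNIV (\<lambda>p::'a \<times> 'a. proj (snd p - N (fst p)))"
    by (intro continuous_intros continuous_on_compose2[OF continuous_N[of UNIV]]) auto
  show ?thesis
    by (intro continuous_on_Pair * continuous_on_uncurry[OF continuous_fold_coord] continuous_intros) auto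
qed

lemma continuous_zeta_inv: "continuous_on ({z. z \<bullet> \<phi> = 0} \<times> UNIV) zeta_inv"
proof -
  have u: "continuous_on ({z. z \<bullet> \<phi> = 0} \<times> UNIV) (\<lambda>q. unfold_coord (fst q) (snd q))"
    by (intro continuous_on_uncurry[OF continuous_unfold_coord] continuous_intros) auto
  show ?thesis unfolding zeta_inv_def[abs_def]
    by (rule continuous_on_uncurry[OF continuous_fib]) (auto intro: u continuous_intros)
qed

lemma continuous_T_zeta_inv:
  "continuous_on ({z. z \<bullet> \<phi> = 0} \<times> UNIV) (\<lambda>q. (zeta_inv q, T (zeta_inv q)))"
proof -
  have u: "continuous_on ({z. z \<bullet> \<phi> = 0} \<times> UNIV) (\<lambda>q. unfold_coord (fst q) (snd q))"
    by (intro continuous_on_uncurry[OF continuous_unfold_coord] continuous_intros) auto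
  have h: "continuous_on ({z. z \<bullet> \<phi> = 0} \<times> UNIV) (\<lambda>q. height (fst q) (unfold_coord (fst q) (snd q)))"
    by (rule continuous_on_uncurry[OF continuous_height]) (auto intro: u continuous_intros)
  have "continuous_on ({z. z \<bullet> \<phi> = 0} \<times> UNIV)
      (\<lambda>q. (zeta_inv q, N (zeta_inv q) + (fst q + height (fst q) (unfold_coord (fst q) (snd q)) *\<^sub>R \<phi>)))"
    by (intro continuous_intros h continuous_zeta_inv continuous_on_compose2[OF continuous_N[of UNIV]]) auto
  then show ?thesis
  proof (rule continuous_on_eq)
    fix q assume "q \<in> {z. z \<bullet> \<phi> = 0} \<times> (UNIV :: real set)"
    then show "(zeta_inv q, N (zeta_inv q) + (fst q + height (fst q) (unfold_coord (fst q) (snd q)) *\<^sub>R \<phi>))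
        = (zeta_inv q, T (zeta_inv q))"
      using height_decomp[of "fst q" "unfold_coord (fst q) (snd q)"]
      by (auto simp: zeta_inv_def algebra_simps)
  qed
qed

lemma continuous_top_fst: "continuous_on A g \<Longrightarrow> g ` A \<subseteq> {z. z \<bullet> \<phi> = 0} \<Longrightarrow> continuous_on A (\<lambda>x. top_value (g x))"
  by (rule continuous_on_compose2[OF continuous_top])

lemma continuous_xi: "continuous_on UNIV xi"
  unfolding xi_def[abs_def] by (intro continuous_intros continuous_top_fst) auto

lemma continuous_xi_inv: "continuous_on ({z. z \<bullet> \<phi> = 0} \<times> UNIV) xi_inv"
  unfolding xi_inv_def[abs_def] by (intro continuous_intros continuous_top_fst) auto

end

lemma cont_betweenI:
  fixes j :: "'a \<Rightarrow> 'c::metric_space" and j' :: "'b \<Rightarrow> 'd::metric_space"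
  assumes k: "continuous_on (j ` S) k" "\<And>x. x \<in> S \<Longrightarrow> k (j x) = j' (g x)"
    and d: "\<And>x y. x \<in> S \<Longrightarrow> y \<in> S \<Longrightarrow> dist (j x) (j y) \<le> d x y"
    and d': "\<And>x y. x \<in> S \<Longrightarrow> y \<in> S \<Longrightarrow> d' (g x) (g y) \<le> 2 * dist (j' (g x)) (j' (g y))"
  shows "cont_between S d d' g"
  unfolding cont_between_def
proof (intro ballI allI impI)
  fix x e assume x: "x \<in> S" and e: "e > (0::real)"
  obtain \<delta> where \<delta>: "\<delta> > 0" "\<And>p. p \<in> j ` S \<Longrightarrow> dist p (j x) < \<delta> \<Longrightarrow> dist (k p) (k (j x)) < e/2"
    using k(1) x e unfolding continuous_on_iff by (meson half_gt_zero imageI)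
  have "d' (g x) (g y) < e" if y: "y \<in> S" "d x y < \<delta>" for y
  proof -
    have "dist (k (j y)) (k (j x)) < e/2"
      using \<delta>(2)[of "j y"] y d[OF x y(1)] by (simp add: dist_commute)
    then have "2 * dist (j' (g x)) (j' (g y)) < e"
      using k(2) x y by (simp add: dist_commute)
    then show ?thesis using d'[OF x y(1)] by simp
  qed
  then show "\<exists>\<delta>>0. \<forall>y\<in>S. d x y < \<delta> \<longrightarrow> d' (g x) (g y) < e" using \<delta>(1) by blast
qed

lemma homeo_betweenI:
  assumes g: "\<And>x. x \<in> S \<Longrightarrow> g x \<in> S'" "\<And>x. x \<in> S \<Longrightarrow> h (g x) = x"
    and h: "\<And>y. y \<in> S' \<Longrightarrow> h y \<in> S" "\<And>y. y \<in> S' \<Longrightarrow> g (h y) = y"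
    and cont: "cont_between S d d' g" "cont_between S' d' d h"
  shows "homeo_between S d S' d' g" and "\<And>y. y \<in> S' \<Longrightarrow> inv_into S g y = h y"
proof -
  have bij: "bij_betw g S S'"
    by (rule bij_betwI[where g = h]) (use g h in auto)
  then show inv: "\<And>y. y \<in> S' \<Longrightarrow> inv_into S g y = h y"
    using h by (metis bij_betw_inv_into_left)
  show "homeo_between S d S' d' g"
    using bij cont inv unfolding homeo_between_def cont_between_def by simp
qed

lemma dist_prod_bounds:
  fixes p q :: "'a::real_normed_vector \<times> 'b::real_normed_vector"
  shows "dist p q \<le> norm (fst p - fst q) + norm (snd p - snd q)"
    and "norm (fst p - fst q) + norm (snd p - snd q) \<le> 2 * dist p q"
proof -
  show "dist p q \<le> norm (fst p - fst q) + norm (snd p - snd q)"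
    unfolding dist_prod_def dist_norm by (rule sqrt_sum_squares_le_sum) auto
  show "norm (fst p - fst q) + norm (snd p - snd q) \<le> 2 * dist p q"
    using dist_fst_le[of p q] dist_snd_le[of p q] by (simp add: dist_norm)
qed

lemma L2_norm_eq: "L2_norm u = norm u"
  by (simp add: norm_L2_def)

lemma L2_inner_eq: "L2_inner u w = inner u w"
  by (simp add: inner_L2_def)

lemma regular_point_iff: "regular_point T X \<mu> \<longleftrightarrow> \<mu> \<notin> op_spectrum T X"
  by (simp add: regular_point_def op_spectrum_def L2_norm_eq)

lemma symmetric_operator_L2: "self_adjoint T X \<Longrightarrow> symmetric_operator T X"
  unfolding symmetric_operator_def self_adjoint_def L2_inner_eq by blast

lemma inner_nonneg_of_pos:
  assumes "AE x in lborel. 0 < rep u x" "AE x in lborel. 0 < rep w x"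
  shows "0 \<le> inner u w"
  unfolding inner_L2_def L2_inner_def
  by (rule integral_nonneg_AE) (use assms in \<open>eventually_elim, simp\<close>)

lemma frechet_directional:
  fixes T :: "'n::finite L2 \<Rightarrow> 'n L2"
  assumes C1: "frechet_C1 T X F DF" and sym: "symmetric_operator T X" and u: "u \<in> X" and h: "h \<in> X"
  shows "((\<lambda>s. (1/s) *\<^sub>R (F (u + s *\<^sub>R h) - F u)) \<longlongrightarrow> DF u h) (at 0)"
proof (rule tendstoI)
  interpret symmetric_operator T X by (rule sym)
  fix e :: real assume e: "e > 0"
  define k where "k = gnorm T h"
  have k: "k \<ge> 0" by (simp add: k_def gnorm_def L2_norm_eq)
  define \<epsilon> where "\<epsilon> = e / (2 * (k + 1))"
  have \<epsilon>: "\<epsilon> > 0" using e k by (simp add: \<epsilon>_def)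
  then obtain \<delta> where \<delta>: "\<delta> > 0" "\<And>w. w \<in> X \<Longrightarrow> gnorm T (w - u) < \<delta> \<Longrightarrow>
      norm (F w - F u - DF u (w - u)) \<le> \<epsilon> * gnorm T (w - u)"
    using C1 u unfolding frechet_C1_def L2_norm_eq by meson
  have lin: "DF u (s *\<^sub>R h) = s *\<^sub>R DF u h" for s
    using C1 u h unfolding frechet_C1_def by blast
  have "dist ((1/s) *\<^sub>R (F (u + s *\<^sub>R h) - F u)) (DF u h) < e"
    if s: "s \<noteq> 0" "dist s 0 < \<delta> / (k + 1)" for s
  proof -
    have g: "gnorm T ((u + s *\<^sub>R h) - u) = \<bar>s\<bar> * k"
      by (simp add: gnorm_def L2_norm_eq k_def T_scale h distrib_left)
    have "\<bar>s\<bar> * k \<le> \<bar>s\<bar> * (k + 1)" by (simp add: mult_left_mono)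
    also have "\<dots> < \<delta>" using s(2) k by (simp add: field_simps)
    finally have "norm (F (u + s *\<^sub>R h) - F u - s *\<^sub>R DF u h) \<le> \<epsilon> * (\<bar>s\<bar> * k)"
      using \<delta>(2)[of "u + s *\<^sub>R h"] u h g lin by (simp add: add_in scale_in)
    moreover have "dist ((1/s) *\<^sub>R (F (u + s *\<^sub>R h) - F u)) (DF u h)
        = norm (F (u + s *\<^sub>R h) - F u - s *\<^sub>R DF u h) / \<bar>s\<bar>"
    proof -
      have "(1/s) *\<^sub>R (F (u + s *\<^sub>R h) - F u) - DF u h = (1/s) *\<^sub>R (F (u + s *\<^sub>R h) - F u - s *\<^sub>R DF u h)"
        using s(1) by (simp add: scaleR_diff_right)
      then show ?thesis by (simp only: dist_norm norm_scaleR) simp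
    qed
    ultimately have "dist ((1/s) *\<^sub>R (F (u + s *\<^sub>R h) - F u)) (DF u h) \<le> \<epsilon> * k"
      using s(1) by (simp add: pos_divide_le_eq mult_ac)
    also have "\<dots> < e" using e k by (simp add: \<epsilon>_def field_simps add_nonneg_pos)
    finally show ?thesis .
  qed
  moreover have "\<delta> / (k + 1) > 0" using \<delta>(1) k by simp
  ultimately show "\<forall>\<^sub>F s in at 0. dist ((1/s) *\<^sub>R (F (u + s *\<^sub>R h) - F u)) (DF u h) < e"
    unfolding eventually_at by blast
qed

theorem mainTheorem11:
  fixes v :: "real^'n::finite \<Rightarrow> real"
    and T :: "'n L2 \<Rightarrow> 'n L2" and X :: "'n L2 set"
    and f :: "real \<Rightarrow> real" and DF :: "'n L2 \<Rightarrow> 'n L2 \<Rightarrow> 'n L2"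
    and lam1 a b M :: real and phi1 :: "'n L2"
  assumes v_meas: "v \<in> borel_measurable lborel"
    and T_sa: "self_adjoint T X"
    and T_schr: "schroedinger_op v T X"
    and ground: "ground_state T X lam1 phi1"
    and F_C1: "frechet_C1 T X (\<lambda>u. T u - nemytskii f u) DF"
    and f_C2: "\<forall>x. f differentiable (at x)" "\<forall>x. deriv f differentiable (at x)"
              "continuous_on UNIV (deriv (deriv f))"
    and f0: "f 0 = 0"
    and f2: "\<forall>x. 0 < deriv (deriv f) x \<and> deriv (deriv f) x \<le> M"
    and f1: "range (deriv f) = {a<..<b}"
    and gap: "a < lam1" "lam1 < b" "\<forall>\<mu>\<in>op_spectrum T X - {lam1}. b < \<mu>"
    and DF_sa: "\<forall>u\<in>X. self_adjoint (DF u) X \<and> (\<exists>lam phi. ground_state (DF u) X lam phi)"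
  shows "\<exists>\<zeta> \<xi>.
     homeo_between X (\<lambda>u w. gnorm T (u - w)) ({y. L2_inner y phi1 = 0} \<times> UNIV) sum_dist \<zeta> \<and>
     homeo_between UNIV (\<lambda>u w. L2_norm (u - w)) ({y. L2_inner y phi1 = 0} \<times> UNIV) sum_dist \<xi> \<and>
     (\<forall>z\<in>{y. L2_inner y phi1 = 0}. \<forall>t.
        \<xi> (T (inv_into X \<zeta> (z, t)) - nemytskii f (inv_into X \<zeta> (z, t))) = (z, - (t^2)))"
proof -
  define \<phi> where "\<phi> = (1 / norm phi1) *\<^sub>R phi1"
  have phi1: "phi1 \<in> X" "phi1 \<noteq> 0" "T phi1 = lam1 *\<^sub>R phi1" "AE x in lborel. 0 < rep phi1 x"
    and simple: "\<And>u. u \<in> X \<Longrightarrow> T u = lam1 *\<^sub>R u \<Longrightarrow> \<exists>c. u = c *\<^sub>R phi1"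
    using ground by (auto simp: ground_state_def)
  have phi1_eq: "phi1 = norm phi1 *\<^sub>R \<phi>" using phi1(2) by (simp add: \<phi>_def)
  have sym: "symmetric_operator T X" using T_sa by (rule symmetric_operator_L2)
  interpret S: symmetric_operator T X by (rule sym)
  have phi_pos: "AE x in lborel. 0 < rep \<phi> x"
    using rep_scaleR[of "1 / norm phi1" phi1] phi1(4) unfolding \<phi>_def
    by eventually_elim (use phi1(2) in simp)
  interpret A: ground_gap T X lam1 b \<phi>
  proof unfold_locales
    show "\<phi> \<in> X" "T \<phi> = lam1 *\<^sub>R \<phi>"
      using phi1 by (simp_all add: \<phi>_def S.scale_in S.T_scale)
    show "norm \<phi> = 1" using phi1(2) by (simp add: \<phi>_def)
    show "\<exists>c. u = c *\<^sub>R \<phi>" if u: "u \<in> X" "T u = lam1 *\<^sub>R u" for u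
    proof -
      obtain c where "u = c *\<^sub>R phi1" using simple[OF u] by blast
      then have "u = (c * norm phi1) *\<^sub>R \<phi>" by (subst (asm) phi1_eq) simp
      then show ?thesis by blast
    qed
    show "lam1 < b" by (rule gap)
    show "regular_point T X \<mu>" if "\<mu> \<le> b" "\<mu> \<noteq> lam1" for \<mu>
      unfolding regular_point_iff using gap(3) that by (meson DiffI not_le singletonD)
  qed
  obtain \<beta> where \<beta>: "\<beta> > b" "\<And>u. u \<in> X \<Longrightarrow> inner u \<phi> = 0 \<Longrightarrow> \<beta> * inner u u \<le> inner (T u) u"
    using A.gap by blast
  have ab: "a < b" using gap by simp
  obtain \<gamma> where \<gamma>: "(a + b) / 2 < \<gamma>" "\<gamma> < b" "\<gamma> < (a + \<beta>) / 2" "\<gamma> \<noteq> lam1"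
  proof -
    have "(a + b) / 2 < min b ((a + \<beta>) / 2)" using ab \<beta>(1) by simp
    then obtain g1 where g1: "(a + b) / 2 < g1" "g1 < min b ((a + \<beta>) / 2)" using dense by blast
    then obtain g2 where "g1 < g2" "g2 < min b ((a + \<beta>) / 2)" using dense by blast
    then show thesis using that[of g1] that[of g2] g1 by (cases "g1 = lam1") auto
  qed
  define r where "r = \<gamma> - a"
  interpret A: sheet T X lam1 b \<phi> \<beta> \<gamma> r
    by unfold_locales (use \<beta> \<gamma> ab in \<open>auto simp: r_def field_simps\<close>)
  interpret C: convex_nonlinearity f "deriv f" a b
  proof unfold_locales
    show "DERIV f x :> deriv f x" for x
      using f_C2(1) by (simp add: DERIV_deriv_iff_real_differentiable)
    have D: "DERIV (deriv f) x :> deriv (deriv f) x" for x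
      using f_C2(2) by (simp add: DERIV_deriv_iff_real_differentiable)
    show "strict_mono (deriv f)"
    proof (rule strict_monoI)
      fix x y :: real assume "x < y"
      then show "deriv f x < deriv f y"
        by (rule DERIV_pos_imp_increasing) (use D f2 in blast)
    qed
  qed (use f0 f1 in auto)
  have near: "\<bar>deriv f x - \<gamma>\<bar> \<le> r" for x
    using C.f'_bounds[of x] \<gamma> by (simp add: r_def abs_le_iff field_simps)
  have r: "r \<ge> 0" using near[of 0] by linarith
  have DF: "DF u h = T h - C.mult_op u h" if u: "u \<in> X" and h: "h \<in> X" for u h
  proof -
    have "((\<lambda>s. T h - (1/s) *\<^sub>R (nemytskii f (u + s *\<^sub>R h) - nemytskii f u)) \<longlongrightarrow> T h - C.mult_op u h) (at 0)"
      by (intro tendsto_intros C.nemytskii_gateaux)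
    moreover have "\<forall>\<^sub>F s in at 0. T h - (1/s) *\<^sub>R (nemytskii f (u + s *\<^sub>R h) - nemytskii f u)
        = (1/s) *\<^sub>R ((T (u + s *\<^sub>R h) - nemytskii f (u + s *\<^sub>R h)) - (T u - nemytskii f u))"
      using u h by (auto simp: eventually_at_filter S.T_add S.T_scale S.scale_in algebra_simps)
    ultimately have "((\<lambda>s. (1/s) *\<^sub>R ((T (u + s *\<^sub>R h) - nemytskii f (u + s *\<^sub>R h)) - (T u - nemytskii f u)))
        \<longlongrightarrow> T h - C.mult_op u h) (at 0)"
      by (rule Lim_transform_eventually)
    from tendsto_unique[OF _ frechet_directional[OF F_C1 sym u h] this] show ?thesis by simp
  qed
  interpret A: fold_map T X lam1 b \<phi> \<beta> \<gamma> r "nemytskii f" C.mult_op a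
  proof unfold_locales
    fix u p assume u: "u \<in> X" and p: "p \<in> X" "p \<noteq> 0" "T p = C.mult_op u p"
    obtain \<mu> \<psi> where "ground_state (DF u) X \<mu> \<psi>" using DF_sa u by blast
    then have low: "\<And>\<nu>. \<nu> \<in> op_spectrum (DF u) X \<Longrightarrow> \<mu> \<le> \<nu>"
      and \<psi>: "\<psi> \<in> X" "\<psi> \<noteq> 0" "DF u \<psi> = \<mu> *\<^sub>R \<psi>" "AE x in lborel. 0 < rep \<psi> x"
      and simp: "\<And>w. w \<in> X \<Longrightarrow> DF u w = \<mu> *\<^sub>R w \<Longrightarrow> \<exists>c. w = c *\<^sub>R \<psi>"
      by (auto simp: ground_state_def)
    have p0: "DF u p = 0" using DF[OF u p(1)] p(3) by simp
    have "DF u 0 = 0"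
      using DF[OF u S.zero_in] S.T_scale[OF p(1), of 0] linear_0[OF C.mult_op_linear] by simp
    then have "\<not> inj_on (\<lambda>w. DF u w - 0 *\<^sub>R w) X"
      using p(1,2) p0 S.zero_in inj_onD[of "\<lambda>w. DF u w - 0 *\<^sub>R w" X p 0] by auto
    then have "0 \<in> op_spectrum (DF u) X" by (auto simp: op_spectrum_def bij_betw_def)
    then have "\<mu> \<le> 0" by (rule low)
    moreover have "T \<psi> - C.mult_op u \<psi> = \<mu> *\<^sub>R \<psi>" using DF[OF u \<psi>(1)] \<psi>(3) by simp
    moreover have "\<mu> = 0 \<longrightarrow> (\<exists>c. p = c *\<^sub>R \<psi>)" using simp[OF p(1)] p0 by simp
    moreover have "0 \<le> inner \<psi> \<phi>" by (rule inner_nonneg_of_pos[OF \<psi>(4) phi_pos])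
    ultimately show "\<exists>\<psi> \<mu>. \<psi> \<in> X \<and> \<psi> \<noteq> 0 \<and> \<mu> \<le> 0 \<and> T \<psi> - C.mult_op u \<psi> = \<mu> *\<^sub>R \<psi> \<and>
        (\<mu> = 0 \<longrightarrow> (\<exists>c. p = c *\<^sub>R \<psi>)) \<and> 0 \<le> inner \<psi> \<phi> \<and>
        (\<forall>w. w \<noteq> u \<longrightarrow> 0 < inner (nemytskii f w - nemytskii f u - C.mult_op u (w - u)) \<psi>)"
      using \<psi> C.nemytskii_strictly_convex[OF \<psi>(4)] by blast
  qed (use gap C.nemytskii_ray_at_top[OF phi_pos] C.nemytskii_ray_at_bot[OF phi_pos]
      linear_add[OF C.mult_op_linear] linear_scale[OF C.mult_op_linear] C.mult_op_sym C.nemytskii_gateaux C.nemytskii_near[OF near r] C.mult_op_near[OF near r]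
      in \<open>auto simp: A.near_gamma_def\<close>)
  have H: "{y. L2_inner y phi1 = 0} = {z. inner z \<phi> = 0}"
    using phi1(2) by (simp add: L2_inner_eq \<phi>_def)
  let ?H = "{z. inner z \<phi> = 0} \<times> (UNIV :: real set)"
  let ?J = "\<lambda>u. (u, T u)"
  have gn: "dist (?J u) (?J w) \<le> gnorm T (u - w)" "gnorm T (u - w) \<le> 2 * dist (?J u) (?J w)"
    if "u \<in> X" "w \<in> X" for u w
    using that dist_prod_bounds[of "?J u" "?J w"] by (simp_all add: gnorm_def L2_norm_eq S.T_diff)
  have sd: "dist p q \<le> sum_dist p q" "sum_dist p q \<le> 2 * dist p q" for p q :: "'n L2 \<times> real"
    using dist_prod_bounds[of p q] by (simp_all add: sum_dist_def L2_norm_eq)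
  have zeta_cont: "cont_between X (\<lambda>u w. gnorm T (u - w)) sum_dist A.zeta"
  proof (rule cont_betweenI[where j = ?J and j' = id])
    show "continuous_on (?J ` X) (\<lambda>p. (A.proj (snd p - nemytskii f (fst p)),
        A.fold_coord (A.proj (snd p - nemytskii f (fst p))) (inner (fst p) \<phi>)))"
      using A.continuous_zeta by (rule continuous_on_subset) simp
  qed (simp_all add: A.zeta_def Let_def gn sd)
  have zeta_inv_cont: "cont_between ?H sum_dist (\<lambda>u w. gnorm T (u - w)) A.zeta_inv"
  proof (rule cont_betweenI[where j = id and j' = ?J])
    show "continuous_on (id ` ?H) (\<lambda>q. (A.zeta_inv q, T (A.zeta_inv q)))"
      using A.continuous_T_zeta_inv by simp
  qed (simp_all add: A.zeta_inv_in gn sd)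
  have xi_cont: "cont_between UNIV (\<lambda>u w. L2_norm (u - w)) sum_dist A.xi"
    by (rule cont_betweenI[where j = id and j' = id and k = A.xi])
      (simp_all add: A.continuous_xi L2_norm_eq dist_norm[symmetric] sd)
  have xi_inv_cont: "cont_between ?H sum_dist (\<lambda>u w. L2_norm (u - w)) A.xi_inv"
    by (rule cont_betweenI[where j = id and j' = id and k = A.xi_inv])
      (simp_all add: A.continuous_xi_inv L2_norm_eq dist_norm[symmetric] sd)
  note zeta = homeo_betweenI[OF A.zeta_range A.zeta_inv_zeta A.zeta_inv_in A.zeta_zeta_inv zeta_cont zeta_inv_cont]
  note xi = homeo_betweenI[OF A.xi_range A.xi_inv_xi UNIV_I A.xi_xi_inv xi_cont xi_inv_cont]
  show ?thesis
    unfolding H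
  proof (rule exI[of _ A.zeta], rule exI[of _ A.xi], intro conjI ballI allI)
    fix z :: "'n L2" and t :: real assume "z \<in> {z. inner z \<phi> = 0}"
    then show "A.xi (T (inv_into X A.zeta (z, t)) - nemytskii f (inv_into X A.zeta (z, t))) = (z, - (t\<^sup>2))"
      using A.xi_F_zeta_inv[of z t] zeta(2)[of "(z, t)"] by simp
  qed (use zeta(1) xi(1) in auto)
qed

end
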